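(* Let $(\mathcal{A},\mathfrak{a}):\Delta_3\to\mathrm{Cat}$ be a pseudofunctor, with lax descent category $\mathrm{lax}\text{-}\mathrm{Desc}(\mathcal{A})$ and forgetful functor $\mathsf{d}^{\mathcal{A}}:\mathrm{lax}\text{-}\mathrm{Desc}(\mathcal{A})\to\mathcal{A}(\mathsf{1})$. If a functor $F$ is equal to $\mathsf{d}^{\mathcal{A}}$ composed with an equivalence (that is, $F=E\circ\mathsf{d}^{\mathcal{A}}$ or $F=\mathsf{d}^{\mathcal{A}}\circ E$ for some equivalence of categories $E$), then $F$ creates absolute limits and colimits.
   Context: $\mathrm{Cat}$ is the $2$-category of categories in some universe. The category $\Delta_3$: the subcategory of the category of finite nonempty ordinals and order-preserving maps with objects $\mathsf{1},\mathsf{2},\mathsf{3}$ generated by the maps $d^0,d^1:\mathsf{1}\to\mathsf{2}$, $s^0:\mathsf{2}\to\mathsf{1}$, $D^0,D^1,D^2:\mathsf{2}\to\mathsf{3}$ (the usual cofaces, $d^i$ and $D^i$ omitting $i$ from the image, and codegeneracy), subject to $s^0d^1=\mathrm{id}_{\mathsf{1}}=s^0d^0$ and $D^td^k=D^kd^{t-1}$ for $t>k$. A pseudofunctor $(\mathcal{A},\mathfrak{a}):\Delta_3\to\mathrm{Cat}$ has invertible natural transformations $\mathfrak{a}_{hg}:\mathcal{A}(h)\mathcal{A}(g)\Rightarrow\mathcal{A}(hg)$ and $\mathfrak{a}_x:\mathrm{id}_{\mathcal{A}(x)}\Rightarrow\mathcal{A}(\mathrm{id}_x)$ satisfying the usual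 coherence equations. Put $\mathcal{A}(\sigma_{01})=\mathfrak{a}_{D^0d^0}^{-1}\cdot\mathfrak{a}_{D^1d^0}$, $\mathcal{A}(\sigma_{02})=\mathfrak{a}_{D^0d^1}^{-1}\cdot\mathfrak{a}_{D^2d^0}$, $\mathcal{A}(\sigma_{12})=\mathfrak{a}_{D^1d^1}^{-1}\cdot\mathfrak{a}_{D^2d^1}$, $\mathcal{A}(\mathfrak{n}_0)=\mathfrak{a}_{\mathsf{1}}^{-1}\cdot\mathfrak{a}_{s^0d^0}$, $\mathcal{A}(\mathfrak{n}_1)=\mathfrak{a}_{\mathsf{1}}^{-1}\cdot\mathfrak{a}_{s^0d^1}$. Lax descent category $\mathrm{lax}\text{-}\mathrm{Desc}(\mathcal{A})$: objects are pairs $(w,\varphi)$ with $w$ an object of $\mathcal{A}(\mathsf{1})$ and $\varphi:\mathcal{A}(d^1)(w)\to\mathcal{A}(d^0)(w)$ a morphism of $\mathcal{A}(\mathsf{2})$ such that $\mathcal{A}(D^0)(\varphi)\cdot\mathcal{A}(\sigma_{02})_w\cdot\mathcal{A}(D^2)(\varphi)=\mathcal{A}(\sigma_{01})_w\cdot\mathcal{A}(D^1)(\varphi)\cdot\mathcal{A}(\sigma_{12})_w$ and $\mathcal{A}(\mathfrak{n}_0)_w\cdot\mathcal{A}(s^0)(\varphi)=\mathcal{A}(\mathfrak{n}_1)_w$. A morphism $(w,\varphi)\to(w',\varphi')$ is a morphism $m:w\to w'$ of $\mathcal{A}(\mathsf{1})$ with $\mathcal{A}(d^0)(m)\cdot\varphi=\varphi'\cdot\mathcal{A}(d^1)(m)$;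 composition is that of $\mathcal{A}(\mathsf{1})$. The forgetful functor $\mathsf{d}^{\mathcal{A}}$ sends $(w,\varphi)\mapsto w$ and $m\mapsto m$. Limits: for $J:\mathbb{S}\to\mathbb{C}$ with $\mathbb{S}$ a small category, a (conical) limit is absolute if it is preserved by every functor with domain $\mathbb{C}$. A functor $F:\mathbb{B}\to\mathbb{C}$ creates absolute limits if, for every $J:\mathbb{S}\to\mathbb{B}$ with $\mathbb{S}$ small such that the limit of $FJ$ exists and is absolute: (1) any cone over $J$ whose image under $F$ is a limit cone of $FJ$ is a limit cone of $J$, and (2) the limit of $J$ exists and is preserved by $F$. Dually for absolute colimits. *)

theory Defs
  imports Main
begin

section \<open>Categories, functors, natural isomorphisms\<close>

record ('o, 'a) cat =
  Obj :: "'o set"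
  Arr :: "'a set"
  Dom :: "'a \<Rightarrow> 'o"
  Cod :: "'a \<Rightarrow> 'o"
  Ide :: "'o \<Rightarrow> 'a"
  Comp :: "'a \<Rightarrow> 'a \<Rightarrow> 'a"  (infixl "\<cdot>\<index>" 70)

definition hom :: "('o, 'a) cat \<Rightarrow> 'o \<Rightarrow> 'o \<Rightarrow> 'a set" where
  "hom C x y = {f \<in> Arr C. Dom C f = x \<and> Cod C f = y}"

locale category =
  fixes C :: "('o, 'a) cat" (structure)
  assumes Dom_closed: "f \<in> Arr C \<Longrightarrow> Dom C f \<in> Obj C"
    and Cod_closed: "f \<in> Arr C \<Longrightarrow> Cod C f \<in> Obj C"
    and Ide_closed: "x \<in> Obj C \<Longrightarrow> Ide C x \<in> hom C x x"
    and Comp_closed: "\<lbrakk>f \<in> hom C x y; g \<in> hom C y z\<rbrakk> \<Longrightarrow> g \<cdot> f \<in> hom C x z"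
    and Comp_Ide_left: "f \<in> hom C x y \<Longrightarrow> Ide C y \<cdot> f = f"
    and Comp_Ide_right: "f \<in> hom C x y \<Longrightarrow> f \<cdot> Ide C x = f"
    and Comp_assoc: "\<lbrakk>f \<in> hom C w x; g \<in> hom C x y; h \<in> hom C y z\<rbrakk>
                       \<Longrightarrow> (h \<cdot> g) \<cdot> f = h \<cdot> (g \<cdot> f)"

definition op_cat :: "('o, 'a) cat \<Rightarrow> ('o, 'a) cat" where
  "op_cat C = \<lparr>Obj = Obj C, Arr = Arr C, Dom = Cod C, Cod = Dom C, Ide = Ide C,
               Comp = (\<lambda>g f. f \<cdot>\<^bsub>C\<^esub> g)\<rparr>"

definition inverse_arrows :: "('o, 'a) cat \<Rightarrow> 'a \<Rightarrow> 'a \<Rightarrow> bool" where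
  "inverse_arrows C f g \<longleftrightarrow> f \<in> Arr C \<and> g \<in> hom C (Cod C f) (Dom C f)
     \<and> g \<cdot>\<^bsub>C\<^esub> f = Ide C (Dom C f) \<and> f \<cdot>\<^bsub>C\<^esub> g = Ide C (Cod C f)"

definition is_iso :: "('o, 'a) cat \<Rightarrow> 'a \<Rightarrow> bool" where
  "is_iso C f \<longleftrightarrow> (\<exists>g. inverse_arrows C f g)"

definition inv_arr :: "('o, 'a) cat \<Rightarrow> 'a \<Rightarrow> 'a" where
  "inv_arr C f = (THE g. inverse_arrows C f g)"

text \<open>A functor is a pair of functions whose values outside the domain category are
  irrelevant; equality of functors is therefore \<open>eq_functor\<close> below, not record equality.\<close>

record ('o, 'a, 'p, 'b) func =
  omap :: "'o \<Rightarrow> 'p"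
  amap :: "'a \<Rightarrow> 'b"

locale cat_functor = dom: category C + cod: category D
  for C :: "('o, 'a) cat" and D :: "('p, 'b) cat" +
  fixes F :: "('o, 'a, 'p, 'b) func"
  assumes omap_closed: "x \<in> Obj C \<Longrightarrow> omap F x \<in> Obj D"
    and amap_closed: "f \<in> hom C x y \<Longrightarrow> amap F f \<in> hom D (omap F x) (omap F y)"
    and amap_Ide: "x \<in> Obj C \<Longrightarrow> amap F (Ide C x) = Ide D (omap F x)"
    and amap_Comp: "\<lbrakk>f \<in> hom C x y; g \<in> hom C y z\<rbrakk>
                      \<Longrightarrow> amap F (g \<cdot>\<^bsub>C\<^esub> f) = amap F g \<cdot>\<^bsub>D\<^esub> amap F f"

definition id_func :: "('o, 'a, 'o, 'a) func" where
  "id_func = \<lparr>omap = (\<lambda>x. x), amap = (\<lambda>f. f)\<rparr>"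

definition comp_func ::
  "('p, 'b, 'q, 'c) func \<Rightarrow> ('o, 'a, 'p, 'b) func \<Rightarrow> ('o, 'a, 'q, 'c) func"
  (infixl "\<circ>\<^sub>F" 70) where
  "G \<circ>\<^sub>F F = \<lparr>omap = omap G \<circ> omap F, amap = amap G \<circ> amap F\<rparr>"

definition eq_functor ::
  "('o, 'a) cat \<Rightarrow> ('p, 'b) cat \<Rightarrow> ('o, 'a, 'p, 'b) func \<Rightarrow> ('o, 'a, 'p, 'b) func \<Rightarrow> bool" where
  "eq_functor C D F G \<longleftrightarrow> cat_functor C D F \<and> cat_functor C D G
     \<and> (\<forall>x \<in> Obj C. omap F x = omap G x) \<and> (\<forall>f \<in> Arr C. amap F f = amap G f)"

locale natural_iso = F: cat_functor C D F + G: cat_functor C D G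
  for C :: "('o, 'a) cat" and D :: "('p, 'b) cat" and F G +
  fixes t :: "'o \<Rightarrow> 'b"
  assumes component: "x \<in> Obj C \<Longrightarrow> t x \<in> hom D (omap F x) (omap G x)"
    and naturality: "f \<in> hom C x y \<Longrightarrow> amap G f \<cdot>\<^bsub>D\<^esub> t x = t y \<cdot>\<^bsub>D\<^esub> amap F f"
    and invertible: "x \<in> Obj C \<Longrightarrow> is_iso D (t x)"

definition equivalence ::
  "('o, 'a) cat \<Rightarrow> ('p, 'b) cat \<Rightarrow> ('o, 'a, 'p, 'b) func \<Rightarrow> bool" where
  "equivalence C D E \<longleftrightarrow> cat_functor C D E \<and>
     (\<exists>G t u. cat_functor D C G
        \<and> natural_iso C C id_func (G \<circ>\<^sub>F E) t
        \<and> natural_iso D D (E \<circ>\<^sub>F G) id_func u)"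


section \<open>The category \<open>\<Delta>\<^sub>3\<close>\<close>

text \<open>The ordinal \<open>n\<close> is \<open>{0, \<dots>, n - 1}\<close>; an order-preserving map \<open>m \<rightarrow> n\<close> is the pair
  of its list of values (of length \<open>m\<close>) and \<open>n\<close>.\<close>

type_synonym ord_map = "nat list \<times> nat"

definition ordinals :: "(nat, ord_map) cat" where
  "ordinals = \<lparr>Obj = {n. n > 0},
     Arr = {(xs, n). xs \<noteq> [] \<and> sorted xs \<and> set xs \<subseteq> {..<n}},
     Dom = (\<lambda>f. length (fst f)), Cod = snd,
     Ide = (\<lambda>n. ([0..<n], n)),
     Comp = (\<lambda>g f. (map (\<lambda>i. fst g ! i) (fst f), snd g))\<rparr>"

definition coface :: "nat \<Rightarrow> nat \<Rightarrow> ord_map" where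
  "coface i n = (map (\<lambda>j. if j < i then j else Suc j) [0..<n], Suc n)"

definition d0 :: ord_map where "d0 = coface 0 1"
definition d1 :: ord_map where "d1 = coface 1 1"
definition D0 :: ord_map where "D0 = coface 0 2"
definition D1 :: ord_map where "D1 = coface 1 2"
definition D2 :: ord_map where "D2 = coface 2 2"
definition s0 :: ord_map where "s0 = ([0, 0], 1)"

inductive_set Delta3_arr :: "ord_map set" where
  ide: "n \<in> {1, 2, 3} \<Longrightarrow> Ide ordinals n \<in> Delta3_arr"
| gen: "f \<in> {d0, d1, s0, D0, D1, D2} \<Longrightarrow> f \<in> Delta3_arr"
| comp: "\<lbrakk>f \<in> Delta3_arr; g \<in> Delta3_arr; Cod ordinals f = Dom ordinals g\<rbrakk>
          \<Longrightarrow> g \<cdot>\<^bsub>ordinals\<^esub> f \<in> Delta3_arr"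

definition Delta3 :: "(nat, ord_map) cat" where
  "Delta3 = ordinals\<lparr>Obj := {1, 2, 3}, Arr := Delta3_arr\<rparr>"

text \<open>The relations imposed on the generators hold among the maps of ordinals.\<close>

lemma Delta3_relations:
  "s0 \<cdot>\<^bsub>Delta3\<^esub> d1 = Ide Delta3 1" "s0 \<cdot>\<^bsub>Delta3\<^esub> d0 = Ide Delta3 1"
  "D1 \<cdot>\<^bsub>Delta3\<^esub> d0 = D0 \<cdot>\<^bsub>Delta3\<^esub> d0"
  "D2 \<cdot>\<^bsub>Delta3\<^esub> d0 = D0 \<cdot>\<^bsub>Delta3\<^esub> d1"
  "D2 \<cdot>\<^bsub>Delta3\<^esub> d1 = D1 \<cdot>\<^bsub>Delta3\<^esub> d1"
  by (simp_all add: Delta3_def ordinals_def coface_def d0_def d1_def s0_def D0_def D1_def D2_def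
      numeral_2_eq_2)

lemma category_ordinals: "category ordinals"
proof
  fix f assume "f \<in> Arr ordinals"
  then show "Dom ordinals f \<in> Obj ordinals" "Cod ordinals f \<in> Obj ordinals"
    by (auto simp: ordinals_def neq_Nil_conv)
next
  fix x assume "x \<in> Obj ordinals"
  then show "Ide ordinals x \<in> hom ordinals x x"
    by (auto simp: ordinals_def hom_def)
next
  fix f g x y z assume "f \<in> hom ordinals x y" "g \<in> hom ordinals y z"
  then show "g \<cdot>\<^bsub>ordinals\<^esub> f \<in> hom ordinals x z"
    by (fastforce simp: ordinals_def hom_def sorted_iff_nth_mono subset_iff)
next
  fix f x y assume "f \<in> hom ordinals x y"
  then show "Ide ordinals y \<cdot>\<^bsub>ordinals\<^esub> f = f" "f \<cdot>\<^bsub>ordinals\<^esub> Ide ordinals x = f"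
    by (auto simp: ordinals_def hom_def subset_iff map_nth intro!: map_idI)
next
  fix f g h w x y z
  assume "f \<in> hom ordinals w x" "g \<in> hom ordinals x y" "h \<in> hom ordinals y z"
  then show "(h \<cdot>\<^bsub>ordinals\<^esub> g) \<cdot>\<^bsub>ordinals\<^esub> f = h \<cdot>\<^bsub>ordinals\<^esub> (g \<cdot>\<^bsub>ordinals\<^esub> f)"
    by (auto simp: ordinals_def hom_def subset_iff)
qed

lemma Delta3_arr_typing:
  assumes "f \<in> Delta3_arr"
  shows "f \<in> Arr ordinals" "Dom ordinals f \<in> {1, 2, 3}" "Cod ordinals f \<in> {1, 2, 3}"
proof -
  have "f \<in> Arr ordinals \<and> Dom ordinals f \<in> {1, 2, 3} \<and> Cod ordinals f \<in> {1, 2, 3}"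
    using assms
  proof induction
    case (ide n)
    then show ?case by (auto simp: ordinals_def)
  next
    case (gen f)
    then show ?case
      by (auto simp: ordinals_def coface_def d0_def d1_def s0_def D0_def D1_def D2_def
          numeral_2_eq_2 numeral_3_eq_3)
  next
    case (comp f g)
    interpret category ordinals by (rule category_ordinals)
    have "g \<cdot>\<^bsub>ordinals\<^esub> f \<in> hom ordinals (Dom ordinals f) (Cod ordinals g)"
      using comp by (intro Comp_closed[of _ _ "Cod ordinals f"]) (auto simp: hom_def)
    then show ?case using comp by (auto simp: hom_def)
  qed
  then show "f \<in> Arr ordinals" "Dom ordinals f \<in> {1, 2, 3}" "Cod ordinals f \<in> {1, 2, 3}"
    by auto
qed

lemma category_Delta3: "category Delta3"
proof -
  interpret O: category ordinals by (rule category_ordinals)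
  have hom: "hom Delta3 x y = hom ordinals x y \<inter> Delta3_arr" for x y
    using Delta3_arr_typing(1) by (auto simp: hom_def Delta3_def)
  have [simp]: "Comp Delta3 = Comp ordinals" "Ide Delta3 = Ide ordinals"
    "Dom Delta3 = Dom ordinals" "Cod Delta3 = Cod ordinals" "Obj Delta3 = {1, 2, 3}"
    "Arr Delta3 = Delta3_arr"
    by (simp_all add: Delta3_def)
  show ?thesis
  proof
    fix x assume "x \<in> Obj Delta3"
    moreover from this have "x \<in> Obj ordinals" by (auto simp: ordinals_def)
    ultimately show "Ide Delta3 x \<in> hom Delta3 x x"
      using O.Ide_closed Delta3_arr.ide by (auto simp: hom)
  next
    fix f g x y z assume "f \<in> hom Delta3 x y" "g \<in> hom Delta3 y z"
    then show "g \<cdot>\<^bsub>Delta3\<^esub> f \<in> hom Delta3 x z"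
      using O.Comp_closed[of f x y g z] Delta3_arr.comp[of f g]
      unfolding hom by (simp add: hom_def)
  next
    fix f g h w x y z
    assume "f \<in> hom Delta3 w x" "g \<in> hom Delta3 x y" "h \<in> hom Delta3 y z"
    then show "(h \<cdot>\<^bsub>Delta3\<^esub> g) \<cdot>\<^bsub>Delta3\<^esub> f = h \<cdot>\<^bsub>Delta3\<^esub> (g \<cdot>\<^bsub>Delta3\<^esub> f)"
      unfolding hom by (auto intro: O.Comp_assoc)
  qed (use Delta3_arr_typing(2,3) O.Comp_Ide_left O.Comp_Ide_right in
        \<open>auto simp: hom simp del: insert_iff\<close>)
qed


section \<open>Pseudofunctors to \<open>Cat\<close>\<close>

text \<open>The universe of \<open>Cat\<close> is given by the types \<open>'o\<close> and \<open>'a\<close>: its objects are the categories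
  of type \<open>('o, 'a) cat\<close>. The component at \<open>w\<close> of the cell from \<open>A(h) A(g)\<close> to \<open>A(h g)\<close> is
  \<open>pcomp A h g w\<close>, and that of the cell from the identity to \<open>A(id\<^sub>x)\<close> is \<open>punit A x w\<close>.\<close>

record ('s, 'm, 'o, 'a) pseudo =
  pobj :: "'s \<Rightarrow> ('o, 'a) cat"
  parr :: "'m \<Rightarrow> ('o, 'a, 'o, 'a) func"
  pcomp :: "'m \<Rightarrow> 'm \<Rightarrow> 'o \<Rightarrow> 'a"
  punit :: "'s \<Rightarrow> 'o \<Rightarrow> 'a"

locale pseudofunctor = category S
  for S :: "('s, 'm) cat" +
  fixes A :: "('s, 'm, 'o, 'a) pseudo"
  assumes pobj_category: "x \<in> Obj S \<Longrightarrow> category (pobj A x)"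
    and parr_functor: "f \<in> hom S x y \<Longrightarrow> cat_functor (pobj A x) (pobj A y) (parr A f)"
    and pcomp_iso: "\<lbrakk>g \<in> hom S x y; h \<in> hom S y z\<rbrakk> \<Longrightarrow>
      natural_iso (pobj A x) (pobj A z) (parr A h \<circ>\<^sub>F parr A g) (parr A (h \<cdot>\<^bsub>S\<^esub> g)) (pcomp A h g)"
    and punit_iso: "x \<in> Obj S \<Longrightarrow>
      natural_iso (pobj A x) (pobj A x) id_func (parr A (Ide S x)) (punit A x)"
    and pcomp_assoc: "\<lbrakk>f \<in> hom S v x; g \<in> hom S x y; h \<in> hom S y z; w \<in> Obj (pobj A v)\<rbrakk> \<Longrightarrow>
      pcomp A h (g \<cdot>\<^bsub>S\<^esub> f) w \<cdot>\<^bsub>pobj A z\<^esub> amap (parr A h) (pcomp A g f w)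
        = pcomp A (h \<cdot>\<^bsub>S\<^esub> g) f w \<cdot>\<^bsub>pobj A z\<^esub> pcomp A h g (omap (parr A f) w)"
    and punit_right: "\<lbrakk>f \<in> hom S x y; w \<in> Obj (pobj A x)\<rbrakk> \<Longrightarrow>
      pcomp A f (Ide S x) w \<cdot>\<^bsub>pobj A y\<^esub> amap (parr A f) (punit A x w)
        = Ide (pobj A y) (omap (parr A f) w)"
    and punit_left: "\<lbrakk>f \<in> hom S x y; w \<in> Obj (pobj A x)\<rbrakk> \<Longrightarrow>
      pcomp A (Ide S y) f w \<cdot>\<^bsub>pobj A y\<^esub> punit A y (omap (parr A f) w)
        = Ide (pobj A y) (omap (parr A f) w)"


section \<open>The lax descent category\<close>

definition sigma01 :: "(nat, ord_map, 'o, 'a) pseudo \<Rightarrow> 'o \<Rightarrow> 'a" where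
  "sigma01 A w = inv_arr (pobj A 3) (pcomp A D0 d0 w) \<cdot>\<^bsub>pobj A 3\<^esub> pcomp A D1 d0 w"

definition sigma02 :: "(nat, ord_map, 'o, 'a) pseudo \<Rightarrow> 'o \<Rightarrow> 'a" where
  "sigma02 A w = inv_arr (pobj A 3) (pcomp A D0 d1 w) \<cdot>\<^bsub>pobj A 3\<^esub> pcomp A D2 d0 w"

definition sigma12 :: "(nat, ord_map, 'o, 'a) pseudo \<Rightarrow> 'o \<Rightarrow> 'a" where
  "sigma12 A w = inv_arr (pobj A 3) (pcomp A D1 d1 w) \<cdot>\<^bsub>pobj A 3\<^esub> pcomp A D2 d1 w"

definition nu0 :: "(nat, ord_map, 'o, 'a) pseudo \<Rightarrow> 'o \<Rightarrow> 'a" where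
  "nu0 A w = inv_arr (pobj A 1) (punit A 1 w) \<cdot>\<^bsub>pobj A 1\<^esub> pcomp A s0 d0 w"

definition nu1 :: "(nat, ord_map, 'o, 'a) pseudo \<Rightarrow> 'o \<Rightarrow> 'a" where
  "nu1 A w = inv_arr (pobj A 1) (punit A 1 w) \<cdot>\<^bsub>pobj A 1\<^esub> pcomp A s0 d1 w"

definition descent_datum :: "(nat, ord_map, 'o, 'a) pseudo \<Rightarrow> 'o \<times> 'a \<Rightarrow> bool" where
  "descent_datum A = (\<lambda>(w, \<phi>).
     w \<in> Obj (pobj A 1)
     \<and> \<phi> \<in> hom (pobj A 2) (omap (parr A d1) w) (omap (parr A d0) w)
     \<and> amap (parr A D0) \<phi> \<cdot>\<^bsub>pobj A 3\<^esub> sigma02 A w \<cdot>\<^bsub>pobj A 3\<^esub> amap (parr A D2) \<phi>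
         = sigma01 A w \<cdot>\<^bsub>pobj A 3\<^esub> amap (parr A D1) \<phi> \<cdot>\<^bsub>pobj A 3\<^esub> sigma12 A w
     \<and> nu0 A w \<cdot>\<^bsub>pobj A 1\<^esub> amap (parr A s0) \<phi> = nu1 A w)"

text \<open>An arrow of the lax descent category carries its domain and codomain, which \<open>m\<close> alone
  does not determine.\<close>

definition lax_desc ::
  "(nat, ord_map, 'o, 'a) pseudo \<Rightarrow> ('o \<times> 'a, ('o \<times> 'a) \<times> 'a \<times> ('o \<times> 'a)) cat" where
  "lax_desc A = \<lparr>Obj = {p. descent_datum A p},
     Arr = {((w, \<phi>), m, (w', \<phi>')) | w \<phi> m w' \<phi>'.
              descent_datum A (w, \<phi>) \<and> descent_datum A (w', \<phi>') \<and> m \<in> hom (pobj A 1) w w'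
              \<and> amap (parr A d0) m \<cdot>\<^bsub>pobj A 2\<^esub> \<phi> = \<phi>' \<cdot>\<^bsub>pobj A 2\<^esub> amap (parr A d1) m},
     Dom = (\<lambda>(p, m, q). p), Cod = (\<lambda>(p, m, q). q),
     Ide = (\<lambda>p. (p, Ide (pobj A 1) (fst p), p)),
     Comp = (\<lambda>(q, n, r) (p, m, q'). (p, n \<cdot>\<^bsub>pobj A 1\<^esub> m, r))\<rparr>"

definition lax_desc_forget ::
  "('o \<times> 'a, ('o \<times> 'a) \<times> 'a \<times> ('o \<times> 'a), 'o, 'a) func" where
  "lax_desc_forget = \<lparr>omap = fst, amap = (\<lambda>(p, m, q). m)\<rparr>"

lemma Delta3_generators:
  "d0 \<in> hom Delta3 1 2" "d1 \<in> hom Delta3 1 2" "s0 \<in> hom Delta3 2 1"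
  "D0 \<in> hom Delta3 2 3" "D1 \<in> hom Delta3 2 3" "D2 \<in> hom Delta3 2 3"
  by (auto simp: hom_def Delta3_def intro: Delta3_arr.gen)
     (simp_all add: ordinals_def coface_def d0_def d1_def s0_def D0_def D1_def D2_def
      numeral_3_eq_3)

lemma category_lax_desc:
  assumes "pseudofunctor Delta3 A"
  shows "category (lax_desc A)"
    and "cat_functor (lax_desc A) (pobj A 1) lax_desc_forget"
proof -
  note One_nat_def [simp del]
  interpret A: pseudofunctor Delta3 A by fact
  interpret A1: category "pobj A 1" by (rule A.pobj_category) (simp add: Delta3_def)
  interpret A2: category "pobj A 2" by (rule A.pobj_category) (simp add: Delta3_def)
  interpret d0: cat_functor "pobj A 1" "pobj A 2" "parr A d0"
    by (rule A.parr_functor) (rule Delta3_generators)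
  interpret d1: cat_functor "pobj A 1" "pobj A 2" "parr A d1"
    by (rule A.parr_functor) (rule Delta3_generators)
  have datum: "w \<in> Obj (pobj A 1)"
    "\<phi> \<in> hom (pobj A 2) (omap (parr A d1) w) (omap (parr A d0) w)"
    if "descent_datum A (w, \<phi>)" for w \<phi>
    using that by (auto simp: descent_datum_def)
  have hom_iff: "f \<in> hom (lax_desc A) x y \<longleftrightarrow> (\<exists>m. f = (x, m, y)
      \<and> descent_datum A x \<and> descent_datum A y \<and> m \<in> hom (pobj A 1) (fst x) (fst y)
      \<and> amap (parr A d0) m \<cdot>\<^bsub>pobj A 2\<^esub> snd x = snd y \<cdot>\<^bsub>pobj A 2\<^esub> amap (parr A d1) m)" for f x y
    by (cases x; cases y; auto simp: hom_def lax_desc_def)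
  have simps: "Comp (lax_desc A) (q, n, r) (p, m, q') = (p, n \<cdot>\<^bsub>pobj A 1\<^esub> m, r)"
    "Ide (lax_desc A) p = (p, Ide (pobj A 1) (fst p), p)"
    "Obj (lax_desc A) = {p. descent_datum A p}" for p q q' r m n
    by (simp_all add: lax_desc_def)
  show cat: "category (lax_desc A)"
  proof
    fix f assume "f \<in> Arr (lax_desc A)"
    then show "Dom (lax_desc A) f \<in> Obj (lax_desc A)" "Cod (lax_desc A) f \<in> Obj (lax_desc A)"
      by (auto simp: lax_desc_def)
  next
    fix x assume "x \<in> Obj (lax_desc A)"
    then show "Ide (lax_desc A) x \<in> hom (lax_desc A) x x"
      using datum[of "fst x" "snd x"]
      by (auto simp: hom_iff simps d0.amap_Ide d1.amap_Ide A2.Comp_Ide_left A2.Comp_Ide_right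
          A1.Ide_closed)
  next
    fix f g x y z assume "f \<in> hom (lax_desc A) x y" "g \<in> hom (lax_desc A) y z"
    then obtain m n where f: "f = (x, m, y)" and g: "g = (y, n, z)"
      and x: "descent_datum A x" and y: "descent_datum A y" and z: "descent_datum A z"
      and m: "m \<in> hom (pobj A 1) (fst x) (fst y)" and n: "n \<in> hom (pobj A 1) (fst y) (fst z)"
      and eqs: "amap (parr A d0) m \<cdot>\<^bsub>pobj A 2\<^esub> snd x = snd y \<cdot>\<^bsub>pobj A 2\<^esub> amap (parr A d1) m"
        "amap (parr A d0) n \<cdot>\<^bsub>pobj A 2\<^esub> snd y = snd z \<cdot>\<^bsub>pobj A 2\<^esub> amap (parr A d1) n"
      by (auto simp: hom_iff)
    note \<phi> = datum(2)[of "fst x" "snd x", simplified, OF x]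
      datum(2)[of "fst y" "snd y", simplified, OF y] datum(2)[of "fst z" "snd z", simplified, OF z]
    note assoc = A2.Comp_assoc[OF \<phi>(1) d0.amap_closed[OF m] d0.amap_closed[OF n]]
      A2.Comp_assoc[OF d1.amap_closed[OF m] \<phi>(2) d0.amap_closed[OF n]]
      A2.Comp_assoc[OF d1.amap_closed[OF m] d1.amap_closed[OF n] \<phi>(3)]
    have "amap (parr A d0) (n \<cdot>\<^bsub>pobj A 1\<^esub> m) \<cdot>\<^bsub>pobj A 2\<^esub> snd x
        = snd z \<cdot>\<^bsub>pobj A 2\<^esub> amap (parr A d1) (n \<cdot>\<^bsub>pobj A 1\<^esub> m)"
      using assoc eqs by (simp add: d0.amap_Comp[OF m n] d1.amap_Comp[OF m n])
    then show "g \<cdot>\<^bsub>lax_desc A\<^esub> f \<in> hom (lax_desc A) x z"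
      using A1.Comp_closed[OF m n] x z by (simp add: hom_iff simps f g)
  next
    fix f x y assume "f \<in> hom (lax_desc A) x y"
    then show "Ide (lax_desc A) y \<cdot>\<^bsub>lax_desc A\<^esub> f = f" "f \<cdot>\<^bsub>lax_desc A\<^esub> Ide (lax_desc A) x = f"
      by (auto simp: hom_iff simps A1.Comp_Ide_left A1.Comp_Ide_right)
  next
    fix f g h w x y z
    assume "f \<in> hom (lax_desc A) w x" "g \<in> hom (lax_desc A) x y" "h \<in> hom (lax_desc A) y z"
    then show "(h \<cdot>\<^bsub>lax_desc A\<^esub> g) \<cdot>\<^bsub>lax_desc A\<^esub> f = h \<cdot>\<^bsub>lax_desc A\<^esub> (g \<cdot>\<^bsub>lax_desc A\<^esub> f)"
      by (auto simp: hom_iff simps intro: A1.Comp_assoc)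
  qed
  interpret L: category "lax_desc A" by (rule cat)
  show "cat_functor (lax_desc A) (pobj A 1) lax_desc_forget"
    by unfold_locales (auto simp: hom_iff simps lax_desc_forget_def datum)
qed


section \<open>Limits and colimits\<close>

definition cone ::
  "('s, 't) cat \<Rightarrow> ('o, 'a) cat \<Rightarrow> ('s, 't, 'o, 'a) func \<Rightarrow> 'o \<Rightarrow> ('s \<Rightarrow> 'a) \<Rightarrow> bool" where
  "cone S C J c \<tau> \<longleftrightarrow> c \<in> Obj C \<and> (\<forall>s \<in> Obj S. \<tau> s \<in> hom C c (omap J s))
     \<and> (\<forall>f \<in> Arr S. amap J f \<cdot>\<^bsub>C\<^esub> \<tau> (Dom S f) = \<tau> (Cod S f))"

definition limit_cone ::
  "('s, 't) cat \<Rightarrow> ('o, 'a) cat \<Rightarrow> ('s, 't, 'o, 'a) func \<Rightarrow> 'o \<Rightarrow> ('s \<Rightarrow> 'a) \<Rightarrow> bool" where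
  "limit_cone S C J c \<tau> \<longleftrightarrow> cone S C J c \<tau> \<and>
     (\<forall>c' \<tau>'. cone S C J c' \<tau>' \<longrightarrow>
        (\<exists>!u. u \<in> hom C c' c \<and> (\<forall>s \<in> Obj S. \<tau> s \<cdot>\<^bsub>C\<^esub> u = \<tau>' s)))"

definition has_limit ::
  "('s, 't) cat \<Rightarrow> ('o, 'a) cat \<Rightarrow> ('s, 't, 'o, 'a) func \<Rightarrow> bool" where
  "has_limit S C J \<longleftrightarrow> (\<exists>c \<tau>. limit_cone S C J c \<tau>)"

definition preserves_limit ::
  "('s, 't) cat \<Rightarrow> ('o, 'a) cat \<Rightarrow> ('p, 'b) cat \<Rightarrow> ('o, 'a, 'p, 'b) func
     \<Rightarrow> ('s, 't, 'o, 'a) func \<Rightarrow> bool" where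
  "preserves_limit S C D G J \<longleftrightarrow>
     (\<forall>c \<tau>. limit_cone S C J c \<tau> \<longrightarrow> limit_cone S D (G \<circ>\<^sub>F J) (omap G c) (\<lambda>s. amap G (\<tau> s)))"

text \<open>The type argument is the universe from which the codomains of the functors on \<open>C\<close> are
  taken. Absoluteness with respect to a larger universe is a stronger condition.\<close>

definition absolute_limit ::
  "('p, 'b) cat itself \<Rightarrow> ('s, 't) cat \<Rightarrow> ('o, 'a) cat \<Rightarrow> ('s, 't, 'o, 'a) func \<Rightarrow> bool" where
  "absolute_limit U S C J \<longleftrightarrow>
     (\<forall>(D :: ('p, 'b) cat) G. cat_functor C D G \<longrightarrow> preserves_limit S C D G J)"

text \<open>The first type argument is the universe of small categories, over which \<open>S\<close> ranges; the
  second is that of \<open>absolute_limit\<close>.\<close>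

definition creates_absolute_limits ::
  "('s, 't) cat itself \<Rightarrow> ('p, 'b) cat itself \<Rightarrow> ('o, 'a) cat \<Rightarrow> ('q, 'c) cat
     \<Rightarrow> ('o, 'a, 'q, 'c) func \<Rightarrow> bool" where
  "creates_absolute_limits V U B C F \<longleftrightarrow>
     (\<forall>(S :: ('s, 't) cat) J.
        cat_functor S B J \<and> has_limit S C (F \<circ>\<^sub>F J) \<and> absolute_limit U S C (F \<circ>\<^sub>F J) \<longrightarrow>
          (\<forall>c \<tau>. cone S B J c \<tau> \<and> limit_cone S C (F \<circ>\<^sub>F J) (omap F c) (\<lambda>s. amap F (\<tau> s))
             \<longrightarrow> limit_cone S B J c \<tau>)
          \<and> has_limit S B J \<and> preserves_limit S B C F J)"

text \<open>Colimits in \<open>C\<close> are limits in the opposite of \<open>C\<close>. The opposite of a functor has the same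
  underlying functions, so \<open>F\<close> below is the opposite functor.\<close>

definition creates_absolute_colimits ::
  "('s, 't) cat itself \<Rightarrow> ('p, 'b) cat itself \<Rightarrow> ('o, 'a) cat \<Rightarrow> ('q, 'c) cat
     \<Rightarrow> ('o, 'a, 'q, 'c) func \<Rightarrow> bool" where
  "creates_absolute_colimits V U B C F \<longleftrightarrow>
     creates_absolute_limits V U (op_cat B) (op_cat C) F"

end

theory Submission
  imports Defs
begin

text \<open>
  A descent datum is a dialgebra: an object \<open>w\<close> of \<open>A(1)\<close> with an arrow \<open>\<phi> : A(d1)(w) \<rightarrow> A(d0)(w)\<close>,
  subject to two equations. For the purposes of limits, all that matters about these equations is
  that each compares two arrows \<open>H(w) \<rightarrow> K(w)\<close>, for some functors \<open>H\<close> and \<open>K\<close> on \<open>A(1)\<close>, that are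
  built naturally from \<open>(w, \<phi>)\<close>. The locale \<open>equational_dialgebras\<close> describes such categories of
  dialgebras through their forgetful functor \<open>U\<close>.

  Suppose that \<open>U J\<close> has an absolute limit \<open>l\<close> with projections \<open>\<tau>\<close>, and let \<open>a\<close> and \<open>b\<close> be the
  functors that give the source and the target of the structure arrows. Since \<open>b\<close> preserves the
  limit, the structure arrows of the objects \<open>J s\<close> induce a unique \<open>\<phi> : a(l) \<rightarrow> b(l)\<close> for which
  every \<open>\<tau> s\<close> is a morphism of dialgebras. Since every \<open>K\<close> preserves the limit, the arrows \<open>K(\<tau> s)\<close>
  are jointly monic, and the equations for \<open>(l, \<phi>)\<close> follow from those for the \<open>J s\<close>. Joint
  monicity of the \<open>b(\<tau> s)\<close> shows in the same way that the comparison arrows in \<open>A(1)\<close> are morphisms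
  of dialgebras, so that \<open>(l, \<phi>)\<close> is a limit (\<open>lifts_limit_cone\<close> and \<open>reflects_limit_cone\<close> in the
  locale).

  Colimits come for free, as the description is self-dual: on opposite categories \<open>a\<close> and \<open>b\<close> change
  places, and so do \<open>H\<close> and \<open>K\<close>.

  An equivalence preserves, reflects and lifts limits. It also lifts absoluteness: if \<open>E\<close> is an
  equivalence with quasi-inverse \<open>G\<close>, then any functor \<open>H'\<close> on the domain of \<open>E\<close> is isomorphic to
  \<open>(H' G) E\<close>, and \<open>H' G\<close> takes its values in the same universe as \<open>H'\<close>. Therefore creation of absolute
  limits survives composition with an equivalence on either side.
\<close>

section \<open>Isomorphisms, functors and natural isomorphisms\<close>

context category
begin

lemma Arr_hom: "f \<in> Arr C \<Longrightarrow> f \<in> hom C (Dom C f) (Cod C f)"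
  by (simp add: hom_def)

lemma hom_Obj: "f \<in> hom C x y \<Longrightarrow> x \<in> Obj C" "f \<in> hom C x y \<Longrightarrow> y \<in> Obj C"
  using Dom_closed Cod_closed by (auto simp: hom_def)

lemma is_isoI:
  assumes "f \<in> hom C x y" "g \<in> hom C y x" "g \<cdot> f = Ide C x" "f \<cdot> g = Ide C y"
  shows "is_iso C f"
  using assms by (auto simp: is_iso_def inverse_arrows_def hom_def)

lemma inverse_arrows_unique:
  assumes "inverse_arrows C f g" "inverse_arrows C f h"
  shows "g = h"
proof -
  have f: "f \<in> hom C (Dom C f) (Cod C f)"
    and g: "g \<in> hom C (Cod C f) (Dom C f)" and h: "h \<in> hom C (Cod C f) (Dom C f)"
    using assms by (auto simp: inverse_arrows_def hom_def)
  have "g = g \<cdot> (f \<cdot> h)"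
    using assms(2) Comp_Ide_right[OF g] by (simp add: inverse_arrows_def)
  also have "\<dots> = (g \<cdot> f) \<cdot> h"
    using Comp_assoc[OF h f g] by simp
  also have "\<dots> = h"
    using assms(1) Comp_Ide_left[OF h] by (simp add: inverse_arrows_def)
  finally show ?thesis .
qed

lemma inv_arr:
  assumes "f \<in> hom C x y" "is_iso C f"
  shows "inv_arr C f \<in> hom C y x" "inv_arr C f \<cdot> f = Ide C x" "f \<cdot> inv_arr C f = Ide C y"
    "is_iso C (inv_arr C f)"
proof -
  obtain g where g: "inverse_arrows C f g"
    using assms(2) by (auto simp: is_iso_def)
  then have "inv_arr C f = g"
    unfolding inv_arr_def using inverse_arrows_unique by blast
  then show 1: "inv_arr C f \<in> hom C y x" "inv_arr C f \<cdot> f = Ide C x" "f \<cdot> inv_arr C f = Ide C y"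
    using g assms(1) by (auto simp: inverse_arrows_def hom_def)
  then show "is_iso C (inv_arr C f)"
    using assms(1) by (intro is_isoI[of _ y x f])
qed

lemma Comp_inv_cancel:
  assumes i: "i \<in> hom C x y" "is_iso C i"
  shows "f \<in> hom C w y \<Longrightarrow> i \<cdot> (inv_arr C i \<cdot> f) = f"
    and "f \<in> hom C w x \<Longrightarrow> inv_arr C i \<cdot> (i \<cdot> f) = f"
    and "f \<in> hom C y z \<Longrightarrow> (f \<cdot> i) \<cdot> inv_arr C i = f"
    and "f \<in> hom C x z \<Longrightarrow> (f \<cdot> inv_arr C i) \<cdot> i = f"
  using inv_arr[OF i] i(1)
    Comp_assoc[of f w y "inv_arr C i" x i y] Comp_assoc[of f w x i y "inv_arr C i" x]
    Comp_assoc[of "inv_arr C i" y x i y f z] Comp_assoc[of i x y "inv_arr C i" x f z]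
  by (auto simp: Comp_Ide_left Comp_Ide_right)

lemma is_iso_Comp:
  assumes f: "f \<in> hom C x y" "is_iso C f" and g: "g \<in> hom C y z" "is_iso C g"
  shows "is_iso C (g \<cdot> f)"
proof (rule is_isoI)
  note f' = inv_arr[OF f] and g' = inv_arr[OF g]
  show "g \<cdot> f \<in> hom C x z" and gf': "inv_arr C f \<cdot> inv_arr C g \<in> hom C z x"
    using f g f' g' by (auto intro: Comp_closed)
  show "(inv_arr C f \<cdot> inv_arr C g) \<cdot> (g \<cdot> f) = Ide C x"
    using Comp_assoc[OF Comp_closed[OF f(1) g(1)] g'(1) f'(1)] Comp_inv_cancel(2)[OF g f(1)] f'
    by simp
  show "(g \<cdot> f) \<cdot> (inv_arr C f \<cdot> inv_arr C g) = Ide C z"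
    using Comp_assoc[OF gf' f(1) g(1)] Comp_inv_cancel(1)[OF f g'(1)] g' by simp
qed

lemma paste:
  assumes "f \<in> hom C x y" "g \<in> hom C y z" "f' \<in> hom C x' y'" "g' \<in> hom C y' z'"
    and "p \<in> hom C x x'" "q \<in> hom C y y'" "r \<in> hom C z z'"
    and "q \<cdot> f = f' \<cdot> p" "r \<cdot> g = g' \<cdot> q"
  shows "r \<cdot> (g \<cdot> f) = (g' \<cdot> f') \<cdot> p"
proof -
  have "r \<cdot> (g \<cdot> f) = g' \<cdot> (q \<cdot> f)"
    using Comp_assoc[OF assms(1,2,7)] Comp_assoc[OF assms(1,6,4)] assms(9) by simp
  also have "\<dots> = (g' \<cdot> f') \<cdot> p"
    using Comp_assoc[OF assms(5,3,4)] assms(8) by simp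
  finally show ?thesis .
qed

end

lemma comp_func_simps [simp]:
  "omap (G \<circ>\<^sub>F F) x = omap G (omap F x)" "amap (G \<circ>\<^sub>F F) f = amap G (amap F f)"
  by (simp_all add: comp_func_def)

lemma id_func_simps [simp]: "omap id_func x = x" "amap id_func f = f"
  by (simp_all add: id_func_def)

lemma comp_func_assoc: "(H \<circ>\<^sub>F G) \<circ>\<^sub>F F = H \<circ>\<^sub>F (G \<circ>\<^sub>F F)"
  by (simp add: comp_func_def comp_assoc)

lemma comp_func_id: "F \<circ>\<^sub>F id_func = F"
  by (simp add: comp_func_def id_func_def comp_def)

lemma cat_functor_comp:
  assumes "cat_functor C D F" "cat_functor D E G"
  shows "cat_functor C E (G \<circ>\<^sub>F F)"
proof -
  interpret F: cat_functor C D F by fact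
  interpret G: cat_functor D E G by fact
  show ?thesis
    by unfold_locales
      (auto simp: F.omap_closed G.omap_closed F.amap_Ide G.amap_Ide
        F.amap_Comp G.amap_Comp[OF F.amap_closed F.amap_closed]
        intro: F.amap_closed G.amap_closed)
qed

lemma (in cat_functor) preserves_is_iso:
  assumes "f \<in> hom C x y" "is_iso C f"
  shows "is_iso D (amap F f)"
proof -
  note g = dom.inv_arr[OF assms] and xy = dom.hom_Obj[OF assms(1)]
  show ?thesis
  proof (rule cod.is_isoI[OF amap_closed[OF assms(1)] amap_closed[OF g(1)]])
    show "amap F (inv_arr C f) \<cdot>\<^bsub>D\<^esub> amap F f = Ide D (omap F x)"
      using amap_Comp[OF assms(1) g(1)] g(2) amap_Ide[OF xy(1)] by simp
    show "amap F f \<cdot>\<^bsub>D\<^esub> amap F (inv_arr C f) = Ide D (omap F y)"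
      using amap_Comp[OF g(1) assms(1)] g(3) amap_Ide[OF xy(2)] by simp
  qed
qed

lemma natural_iso_inverse:
  assumes "natural_iso C D F G t"
  shows "natural_iso C D G F (\<lambda>x. inv_arr D (t x))"
proof -
  interpret natural_iso C D F G t by fact
  note inv = F.cod.inv_arr[OF component invertible]
  show ?thesis
  proof
    fix f x y assume f: "f \<in> hom C x y"
    note xy = F.dom.hom_Obj[OF f]
    have "amap F f \<cdot>\<^bsub>D\<^esub> inv_arr D (t x)
        = (inv_arr D (t y) \<cdot>\<^bsub>D\<^esub> (t y \<cdot>\<^bsub>D\<^esub> amap F f)) \<cdot>\<^bsub>D\<^esub> inv_arr D (t x)"
      using F.cod.Comp_inv_cancel(2)[OF component[OF xy(2)] invertible[OF xy(2)] F.amap_closed[OF f]]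
      by simp
    also have "\<dots> = (inv_arr D (t y) \<cdot>\<^bsub>D\<^esub> (amap G f \<cdot>\<^bsub>D\<^esub> t x)) \<cdot>\<^bsub>D\<^esub> inv_arr D (t x)"
      using naturality[OF f] by simp
    also have "\<dots> = ((inv_arr D (t y) \<cdot>\<^bsub>D\<^esub> amap G f) \<cdot>\<^bsub>D\<^esub> t x) \<cdot>\<^bsub>D\<^esub> inv_arr D (t x)"
      using F.cod.Comp_assoc[OF component G.amap_closed inv(1)] xy f by simp
    also have "\<dots> = inv_arr D (t y) \<cdot>\<^bsub>D\<^esub> amap G f"
      using F.cod.Comp_inv_cancel(3)[OF component[OF xy(1)] invertible[OF xy(1)]
          F.cod.Comp_closed[OF G.amap_closed[OF f] inv(1)[OF xy(2) xy(2)]]] .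
    finally show "amap F f \<cdot>\<^bsub>D\<^esub> inv_arr D (t x) = inv_arr D (t y) \<cdot>\<^bsub>D\<^esub> amap G f" .
  qed (auto intro: inv)
qed

lemma natural_iso_vertical_comp:
  assumes "natural_iso C D F G t" "natural_iso C D G H u"
  shows "natural_iso C D F H (\<lambda>x. u x \<cdot>\<^bsub>D\<^esub> t x)"
proof -
  interpret t: natural_iso C D F G t by fact
  interpret u: natural_iso C D G H u by fact
  show ?thesis
  proof
    fix f x y assume f: "f \<in> hom C x y"
    then show "amap H f \<cdot>\<^bsub>D\<^esub> (u x \<cdot>\<^bsub>D\<^esub> t x) = (u y \<cdot>\<^bsub>D\<^esub> t y) \<cdot>\<^bsub>D\<^esub> amap F f"
      using t.F.dom.hom_Obj[OF f]
      by (intro t.F.cod.paste[OF t.component u.component t.component u.component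
            t.F.amap_closed t.G.amap_closed u.G.amap_closed])
        (auto simp: t.naturality u.naturality)
  qed (auto intro: t.F.cod.Comp_closed t.F.cod.is_iso_Comp t.component u.component
        t.invertible u.invertible)
qed

lemma natural_iso_whisker_left:
  assumes "natural_iso C D F G t" "cat_functor D E H"
  shows "natural_iso C E (H \<circ>\<^sub>F F) (H \<circ>\<^sub>F G) (\<lambda>x. amap H (t x))"
proof -
  interpret t: natural_iso C D F G t by fact
  interpret H: cat_functor D E H by fact
  interpret HF: cat_functor C E "H \<circ>\<^sub>F F"
    using t.F.cat_functor_axioms assms(2) by (rule cat_functor_comp)
  interpret HG: cat_functor C E "H \<circ>\<^sub>F G"
    using t.G.cat_functor_axioms assms(2) by (rule cat_functor_comp)
  show ?thesis
  proof
    fix f x y assume f: "f \<in> hom C x y"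
    note xy = t.F.dom.hom_Obj[OF f]
    show "amap (H \<circ>\<^sub>F G) f \<cdot>\<^bsub>E\<^esub> amap H (t x) = amap H (t y) \<cdot>\<^bsub>E\<^esub> amap (H \<circ>\<^sub>F F) f"
      using H.amap_Comp[OF t.component t.G.amap_closed, OF _ f]
        H.amap_Comp[OF t.F.amap_closed t.component, OF f] xy t.naturality[OF f] by simp
  qed (auto intro: H.amap_closed t.component H.preserves_is_iso t.invertible)
qed

lemma natural_iso_whisker_right:
  assumes "natural_iso C D F G t" "cat_functor B C H"
  shows "natural_iso B D (F \<circ>\<^sub>F H) (G \<circ>\<^sub>F H) (\<lambda>x. t (omap H x))"
proof -
  interpret t: natural_iso C D F G t by fact
  interpret H: cat_functor B C H by fact
  interpret HF: cat_functor B D "F \<circ>\<^sub>F H"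
    using assms(2) t.F.cat_functor_axioms by (rule cat_functor_comp)
  interpret HG: cat_functor B D "G \<circ>\<^sub>F H"
    using assms(2) t.G.cat_functor_axioms by (rule cat_functor_comp)
  show ?thesis
    by unfold_locales
      (auto intro: H.omap_closed t.component t.invertible t.naturality H.amap_closed)
qed


section \<open>Limit cones\<close>

lemma limit_cone_cong:
  assumes S: "category S"
    and "\<And>s. s \<in> Obj S \<Longrightarrow> omap J s = omap J' s" "\<And>f. f \<in> Arr S \<Longrightarrow> amap J f = amap J' f"
    and "\<And>s. s \<in> Obj S \<Longrightarrow> \<tau> s = \<tau>' s"
  shows "limit_cone S C J c \<tau> \<longleftrightarrow> limit_cone S C J' c \<tau>'"
proof -
  interpret category S by fact
  have "cone S C J c \<tau> \<longleftrightarrow> cone S C J' c \<tau>'"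
    "cone S C J d \<sigma> \<longleftrightarrow> cone S C J' d \<sigma>" for d \<sigma>
    using assms(2-4) Dom_closed Cod_closed by (auto simp: cone_def)
  then show ?thesis
    using assms(4) by (auto simp: limit_cone_def)
qed

lemma cone_arr: "cone S C J c \<tau> \<Longrightarrow> s \<in> Obj S \<Longrightarrow> \<tau> s \<in> hom C c (omap J s)"
  by (simp add: cone_def)

lemma cone_commutes:
  "cone S C J c \<tau> \<Longrightarrow> f \<in> Arr S \<Longrightarrow> amap J f \<cdot>\<^bsub>C\<^esub> \<tau> (Dom S f) = \<tau> (Cod S f)"
  by (simp add: cone_def)

lemma limit_cone_is_cone: "limit_cone S C J c \<tau> \<Longrightarrow> cone S C J c \<tau>"
  by (simp add: limit_cone_def)

lemma limit_cone_factor: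
  assumes "limit_cone S C J c \<tau>" "cone S C J d \<sigma>"
  obtains u where "u \<in> hom C d c" "\<And>s. s \<in> Obj S \<Longrightarrow> \<tau> s \<cdot>\<^bsub>C\<^esub> u = \<sigma> s"
  using assms unfolding limit_cone_def by blast

locale diagram = cat_functor S C J
  for S :: "('s, 't) cat" and C :: "('o, 'a) cat" and J
begin

lemma cone_precomp:
  assumes \<tau>: "cone S C J c \<tau>" and u: "u \<in> hom C d c"
  shows "cone S C J d (\<lambda>s. \<tau> s \<cdot>\<^bsub>C\<^esub> u)"
  unfolding cone_def
proof (intro conjI ballI)
  show "d \<in> Obj C" using cod.hom_Obj[OF u] by simp
  show "\<tau> s \<cdot>\<^bsub>C\<^esub> u \<in> hom C d (omap J s)" if "s \<in> Obj S" for s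
    using cod.Comp_closed[OF u cone_arr[OF \<tau> that]] .
  show "amap J f \<cdot>\<^bsub>C\<^esub> (\<tau> (Dom S f) \<cdot>\<^bsub>C\<^esub> u) = \<tau> (Cod S f) \<cdot>\<^bsub>C\<^esub> u" if f: "f \<in> Arr S" for f
    using cod.Comp_assoc[OF u cone_arr[OF \<tau>] amap_closed, OF _ dom.Arr_hom[OF f]]
      dom.Dom_closed[OF f] cone_commutes[OF \<tau> f] by simp
qed

lemma limit_cone_jointly_monic:
  assumes \<tau>: "limit_cone S C J c \<tau>" and u: "u \<in> hom C d c" and v: "v \<in> hom C d c"
    and eq: "\<And>s. s \<in> Obj S \<Longrightarrow> \<tau> s \<cdot>\<^bsub>C\<^esub> u = \<tau> s \<cdot>\<^bsub>C\<^esub> v"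
  shows "u = v"
proof -
  have "\<exists>!w. w \<in> hom C d c \<and> (\<forall>s \<in> Obj S. \<tau> s \<cdot>\<^bsub>C\<^esub> w = \<tau> s \<cdot>\<^bsub>C\<^esub> v)"
    using \<tau> cone_precomp[OF limit_cone_is_cone[OF \<tau>] v] by (simp add: limit_cone_def)
  then show ?thesis
    using u v eq by blast
qed

lemma limit_coneI:
  assumes "cone S C J c \<tau>"
    and "\<And>d \<sigma>. cone S C J d \<sigma> \<Longrightarrow> \<exists>u \<in> hom C d c. \<forall>s \<in> Obj S. \<tau> s \<cdot>\<^bsub>C\<^esub> u = \<sigma> s"
    and "\<And>d u v. \<lbrakk>u \<in> hom C d c; v \<in> hom C d c; \<forall>s \<in> Obj S. \<tau> s \<cdot>\<^bsub>C\<^esub> u = \<tau> s \<cdot>\<^bsub>C\<^esub> v\<rbrakk> \<Longrightarrow> u = v"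
  shows "limit_cone S C J c \<tau>"
  unfolding limit_cone_def
proof (intro conjI allI impI)
  fix d \<sigma> assume "cone S C J d \<sigma>"
  then obtain u where u: "u \<in> hom C d c" "\<forall>s \<in> Obj S. \<tau> s \<cdot>\<^bsub>C\<^esub> u = \<sigma> s"
    using assms(2) by blast
  then show "\<exists>!u. u \<in> hom C d c \<and> (\<forall>s \<in> Obj S. \<tau> s \<cdot>\<^bsub>C\<^esub> u = \<sigma> s)"
  proof (intro ex1I[of _ u])
    fix v assume v: "v \<in> hom C d c \<and> (\<forall>s \<in> Obj S. \<tau> s \<cdot>\<^bsub>C\<^esub> v = \<sigma> s)"
    then show "v = u"
      using u by (intro assms(3)[of v d u]) auto
  qed simp
qed fact

lemma limit_cone_precomp_iso:
  assumes \<tau>: "limit_cone S C J c \<tau>" and i: "i \<in> hom C d c" "is_iso C i"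
  shows "limit_cone S C J d (\<lambda>s. \<tau> s \<cdot>\<^bsub>C\<^esub> i)"
proof (rule limit_coneI)
  note cone = limit_cone_is_cone[OF \<tau>]
  have assoc: "(\<tau> s \<cdot>\<^bsub>C\<^esub> i) \<cdot>\<^bsub>C\<^esub> u = \<tau> s \<cdot>\<^bsub>C\<^esub> (i \<cdot>\<^bsub>C\<^esub> u)" if "s \<in> Obj S" "u \<in> hom C e d" for s u e
    using cod.Comp_assoc[OF that(2) i(1) cone_arr[OF cone that(1)]] .
  show "cone S C J d (\<lambda>s. \<tau> s \<cdot>\<^bsub>C\<^esub> i)"
    using cone_precomp[OF cone i(1)] .
  show "\<exists>u \<in> hom C e d. \<forall>s \<in> Obj S. (\<tau> s \<cdot>\<^bsub>C\<^esub> i) \<cdot>\<^bsub>C\<^esub> u = \<sigma> s" if \<sigma>: "cone S C J e \<sigma>" for e \<sigma>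
  proof -
    obtain u where u: "u \<in> hom C e c" "\<And>s. s \<in> Obj S \<Longrightarrow> \<tau> s \<cdot>\<^bsub>C\<^esub> u = \<sigma> s"
      by (rule limit_cone_factor[OF \<tau> \<sigma>]) blast
    have "inv_arr C i \<cdot>\<^bsub>C\<^esub> u \<in> hom C e d"
      using cod.Comp_closed[OF u(1) cod.inv_arr(1)[OF i]] .
    then show ?thesis
      using u cod.Comp_inv_cancel(1)[OF i u(1)] by (intro bexI) (auto simp: assoc)
  qed
  show "u = v" if uv: "u \<in> hom C e d" "v \<in> hom C e d"
    and eq: "\<forall>s \<in> Obj S. (\<tau> s \<cdot>\<^bsub>C\<^esub> i) \<cdot>\<^bsub>C\<^esub> u = (\<tau> s \<cdot>\<^bsub>C\<^esub> i) \<cdot>\<^bsub>C\<^esub> v" for e u v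
  proof -
    have "i \<cdot>\<^bsub>C\<^esub> u = i \<cdot>\<^bsub>C\<^esub> v"
    proof (rule limit_cone_jointly_monic[OF \<tau>])
      show "i \<cdot>\<^bsub>C\<^esub> u \<in> hom C e c" "i \<cdot>\<^bsub>C\<^esub> v \<in> hom C e c"
        using uv i(1) by (auto intro: cod.Comp_closed)
      show "\<tau> s \<cdot>\<^bsub>C\<^esub> (i \<cdot>\<^bsub>C\<^esub> u) = \<tau> s \<cdot>\<^bsub>C\<^esub> (i \<cdot>\<^bsub>C\<^esub> v)" if "s \<in> Obj S" for s
        using eq that assoc[OF that uv(1)] assoc[OF that uv(2)] by simp
    qed
    then show "u = v"
      using cod.Comp_inv_cancel(2)[OF i uv(1)] cod.Comp_inv_cancel(2)[OF i uv(2)] by metis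
  qed
qed

lemma limit_cone_unique:
  assumes \<tau>: "limit_cone S C J c \<tau>" and \<sigma>: "limit_cone S C J d \<sigma>"
  obtains i where "i \<in> hom C d c" "is_iso C i" "\<And>s. s \<in> Obj S \<Longrightarrow> \<tau> s \<cdot>\<^bsub>C\<^esub> i = \<sigma> s"
proof -
  note cones = limit_cone_is_cone[OF \<tau>] limit_cone_is_cone[OF \<sigma>]
  obtain i where i: "i \<in> hom C d c" "\<And>s. s \<in> Obj S \<Longrightarrow> \<tau> s \<cdot>\<^bsub>C\<^esub> i = \<sigma> s"
    by (rule limit_cone_factor[OF \<tau> cones(2)]) blast
  obtain j where j: "j \<in> hom C c d" "\<And>s. s \<in> Obj S \<Longrightarrow> \<sigma> s \<cdot>\<^bsub>C\<^esub> j = \<tau> s"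
    by (rule limit_cone_factor[OF \<sigma> cones(1)]) blast
  have "\<tau> s \<cdot>\<^bsub>C\<^esub> (i \<cdot>\<^bsub>C\<^esub> j) = \<tau> s \<cdot>\<^bsub>C\<^esub> Ide C c" if "s \<in> Obj S" for s
    using cod.Comp_assoc[OF j(1) i(1) cone_arr[OF cones(1) that]] i(2)[OF that] j(2)[OF that]
      cod.Comp_Ide_right[OF cone_arr[OF cones(1) that]] by simp
  then have "i \<cdot>\<^bsub>C\<^esub> j = Ide C c"
    using cod.Comp_closed[OF j(1) i(1)] cod.hom_Obj[OF j(1)]
    by - (rule limit_cone_jointly_monic[OF \<tau> _ cod.Ide_closed], auto)
  moreover have "\<sigma> s \<cdot>\<^bsub>C\<^esub> (j \<cdot>\<^bsub>C\<^esub> i) = \<sigma> s \<cdot>\<^bsub>C\<^esub> Ide C d" if "s \<in> Obj S" for s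
    using cod.Comp_assoc[OF i(1) j(1) cone_arr[OF cones(2) that]] i(2)[OF that] j(2)[OF that]
      cod.Comp_Ide_right[OF cone_arr[OF cones(2) that]] by simp
  then have "j \<cdot>\<^bsub>C\<^esub> i = Ide C d"
    using cod.Comp_closed[OF i(1) j(1)] cod.hom_Obj[OF j(1)]
    by - (rule limit_cone_jointly_monic[OF \<sigma> _ cod.Ide_closed], auto)
  ultimately show ?thesis
    using that[OF i(1) cod.is_isoI[OF i(1) j(1)] i(2)] by blast
qed

lemma cone_image:
  assumes "cat_functor C D G" and \<tau>: "cone S C J c \<tau>"
  shows "cone S D (G \<circ>\<^sub>F J) (omap G c) (\<lambda>s. amap G (\<tau> s))"
proof -
  interpret G: cat_functor C D G by fact
  have "amap G (amap J f) \<cdot>\<^bsub>D\<^esub> amap G (\<tau> (Dom S f)) = amap G (\<tau> (Cod S f))" if f: "f \<in> Arr S" for f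
    using G.amap_Comp[OF cone_arr[OF \<tau>] amap_closed, OF _ dom.Arr_hom[OF f]]
      dom.Dom_closed[OF f] cone_commutes[OF \<tau> f] by simp
  then show ?thesis
    using \<tau> by (auto simp: cone_def intro: G.omap_closed G.amap_closed)
qed

text \<open>Any two limits of \<open>J\<close> are isomorphic, and functors preserve isomorphisms.\<close>

lemma preserves_limitI:
  assumes G: "cat_functor C D G" and \<tau>: "limit_cone S C J c \<tau>"
    and G\<tau>: "limit_cone S D (G \<circ>\<^sub>F J) (omap G c) (\<lambda>s. amap G (\<tau> s))"
  shows "preserves_limit S C D G J"
  unfolding preserves_limit_def
proof (intro allI impI)
  fix d \<sigma> assume \<sigma>: "limit_cone S C J d \<sigma>"
  interpret G: cat_functor C D G by fact
  interpret GJ: diagram S D "G \<circ>\<^sub>F J"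
    unfolding diagram_def using cat_functor_axioms G by (rule cat_functor_comp)
  obtain i where i: "i \<in> hom C d c" "is_iso C i" "\<And>s. s \<in> Obj S \<Longrightarrow> \<tau> s \<cdot>\<^bsub>C\<^esub> i = \<sigma> s"
    by (rule limit_cone_unique[OF \<tau> \<sigma>]) blast
  have "limit_cone S D (G \<circ>\<^sub>F J) (omap G d) (\<lambda>s. amap G (\<tau> s) \<cdot>\<^bsub>D\<^esub> amap G i)"
    using GJ.limit_cone_precomp_iso[OF G\<tau> G.amap_closed[OF i(1)] G.preserves_is_iso[OF i(1,2)]] .
  moreover have "amap G (\<tau> s) \<cdot>\<^bsub>D\<^esub> amap G i = amap G (\<sigma> s)" if "s \<in> Obj S" for s
    using G.amap_Comp[OF i(1) cone_arr[OF limit_cone_is_cone[OF \<tau>] that]] i(3)[OF that] by simp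
  ultimately show "limit_cone S D (G \<circ>\<^sub>F J) (omap G d) (\<lambda>s. amap G (\<sigma> s))"
    using limit_cone_cong[OF dom.category_axioms, of "G \<circ>\<^sub>F J" "G \<circ>\<^sub>F J"
        "\<lambda>s. amap G (\<tau> s) \<cdot>\<^bsub>D\<^esub> amap G i"] by simp
qed

end

lemma cone_natural_iso:
  assumes "natural_iso S C J K t" and \<tau>: "cone S C J c \<tau>"
  shows "cone S C K c (\<lambda>s. t s \<cdot>\<^bsub>C\<^esub> \<tau> s)"
  unfolding cone_def
proof (intro conjI ballI)
  interpret natural_iso S C J K t by fact
  show "c \<in> Obj C" using \<tau> by (simp add: cone_def)
  show "t s \<cdot>\<^bsub>C\<^esub> \<tau> s \<in> hom C c (omap K s)" if "s \<in> Obj S" for s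
    using F.cod.Comp_closed[OF cone_arr[OF \<tau> that] component[OF that]] .
  show "amap K f \<cdot>\<^bsub>C\<^esub> (t (Dom S f) \<cdot>\<^bsub>C\<^esub> \<tau> (Dom S f)) = t (Cod S f) \<cdot>\<^bsub>C\<^esub> \<tau> (Cod S f)"
    if f: "f \<in> Arr S" for f
  proof -
    note s = F.dom.Dom_closed[OF f] F.dom.Cod_closed[OF f] and f' = F.dom.Arr_hom[OF f]
    have "amap K f \<cdot>\<^bsub>C\<^esub> (t (Dom S f) \<cdot>\<^bsub>C\<^esub> \<tau> (Dom S f))
        = (t (Cod S f) \<cdot>\<^bsub>C\<^esub> amap J f) \<cdot>\<^bsub>C\<^esub> \<tau> (Dom S f)"
      using F.cod.Comp_assoc[OF cone_arr[OF \<tau> s(1)] component[OF s(1)] G.amap_closed[OF f']]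
        naturality[OF f'] by simp
    also have "\<dots> = t (Cod S f) \<cdot>\<^bsub>C\<^esub> \<tau> (Cod S f)"
      using F.cod.Comp_assoc[OF cone_arr[OF \<tau> s(1)] F.amap_closed[OF f'] component[OF s(2)]]
        cone_commutes[OF \<tau> f] by simp
    finally show ?thesis .
  qed
qed

lemma limit_cone_natural_iso:
  assumes t: "natural_iso S C J K t" and \<tau>: "limit_cone S C J c \<tau>"
  shows "limit_cone S C K c (\<lambda>s. t s \<cdot>\<^bsub>C\<^esub> \<tau> s)"
proof -
  interpret natural_iso S C J K t by fact
  interpret J: diagram S C J by unfold_locales
  interpret K: diagram S C K by unfold_locales
  note cone = limit_cone_is_cone[OF \<tau>]
  have assoc: "(t s \<cdot>\<^bsub>C\<^esub> \<tau> s) \<cdot>\<^bsub>C\<^esub> u = t s \<cdot>\<^bsub>C\<^esub> (\<tau> s \<cdot>\<^bsub>C\<^esub> u)" if "s \<in> Obj S" "u \<in> hom C d c" for s u d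
    using F.cod.Comp_assoc[OF that(2) cone_arr[OF cone that(1)] component[OF that(1)]] .
  show ?thesis
  proof (rule K.limit_coneI)
    show "cone S C K c (\<lambda>s. t s \<cdot>\<^bsub>C\<^esub> \<tau> s)"
      using t cone by (rule cone_natural_iso)
    show "\<exists>u \<in> hom C d c. \<forall>s \<in> Obj S. (t s \<cdot>\<^bsub>C\<^esub> \<tau> s) \<cdot>\<^bsub>C\<^esub> u = \<sigma> s" if \<sigma>: "cone S C K d \<sigma>" for d \<sigma>
    proof -
      obtain u where u: "u \<in> hom C d c"
        "\<And>s. s \<in> Obj S \<Longrightarrow> \<tau> s \<cdot>\<^bsub>C\<^esub> u = inv_arr C (t s) \<cdot>\<^bsub>C\<^esub> \<sigma> s"
        by (rule limit_cone_factor[OF \<tau> cone_natural_iso[OF natural_iso_inverse[OF t] \<sigma>]]) blast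
      then show ?thesis
        using F.cod.Comp_inv_cancel(1)[OF component invertible cone_arr[OF \<sigma>]]
        by (intro bexI[of _ u]) (auto simp: assoc)
    qed
    show "u = v" if uv: "u \<in> hom C d c" "v \<in> hom C d c"
      and eq: "\<forall>s \<in> Obj S. (t s \<cdot>\<^bsub>C\<^esub> \<tau> s) \<cdot>\<^bsub>C\<^esub> u = (t s \<cdot>\<^bsub>C\<^esub> \<tau> s) \<cdot>\<^bsub>C\<^esub> v" for d u v
    proof (rule J.limit_cone_jointly_monic[OF \<tau> uv])
      fix s assume s: "s \<in> Obj S"
      note cancel = F.cod.Comp_inv_cancel(2)[OF component invertible
          F.cod.Comp_closed[OF _ cone_arr[OF cone]], OF s s _ s]
      show "\<tau> s \<cdot>\<^bsub>C\<^esub> u = \<tau> s \<cdot>\<^bsub>C\<^esub> v"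
        using cancel[OF uv(1)] cancel[OF uv(2)] eq assoc[OF s uv(1)] assoc[OF s uv(2)] s by metis
    qed
  qed
qed

text \<open>The naturality squares at the projections \<open>\<tau> s\<close> identify the two image cones up to the
  isomorphisms \<open>t\<close>, on the vertex as well as on the diagram.\<close>

lemma limit_cone_image_natural_iso:
  assumes t: "natural_iso C D G H t" and J: "cat_functor S C J" and \<tau>: "cone S C J c \<tau>"
    and lim: "limit_cone S D (G \<circ>\<^sub>F J) (omap G c) (\<lambda>s. amap G (\<tau> s))"
  shows "limit_cone S D (H \<circ>\<^sub>F J) (omap H c) (\<lambda>s. amap H (\<tau> s))"
proof -
  interpret natural_iso C D G H t by fact
  interpret J: cat_functor S C J by fact
  interpret HJ: diagram S D "H \<circ>\<^sub>F J"
    unfolding diagram_def using J G.cat_functor_axioms by (rule cat_functor_comp)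
  have c: "c \<in> Obj C" using \<tau> by (simp add: cone_def)
  note i = F.cod.inv_arr[OF component[OF c] invertible[OF c]]
  have "limit_cone S D (H \<circ>\<^sub>F J) (omap H c)
      (\<lambda>s. (t (omap J s) \<cdot>\<^bsub>D\<^esub> amap G (\<tau> s)) \<cdot>\<^bsub>D\<^esub> inv_arr D (t c))"
    using HJ.limit_cone_precomp_iso[OF
        limit_cone_natural_iso[OF natural_iso_whisker_right[OF t J] lim] i(1) i(4)] .
  moreover have "(t (omap J s) \<cdot>\<^bsub>D\<^esub> amap G (\<tau> s)) \<cdot>\<^bsub>D\<^esub> inv_arr D (t c) = amap H (\<tau> s)"
    if "s \<in> Obj S" for s
    using naturality[OF cone_arr[OF \<tau> that]]
      F.cod.Comp_inv_cancel(3)[OF component invertible G.amap_closed[OF cone_arr[OF \<tau> that]]] c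
    by simp
  ultimately show ?thesis
    using limit_cone_cong[OF J.dom.category_axioms, of "H \<circ>\<^sub>F J" "H \<circ>\<^sub>F J"
        "\<lambda>s. (t (omap J s) \<cdot>\<^bsub>D\<^esub> amap G (\<tau> s)) \<cdot>\<^bsub>D\<^esub> inv_arr D (t c)"] by simp
qed


section \<open>Equivalences and limits\<close>

text \<open>Naturality recovers \<open>f\<close> from \<open>K f\<close> by conjugation with \<open>t\<close>.\<close>

lemma natural_iso_id_faithful:
  assumes "natural_iso C C id_func K t"
    and fg: "f \<in> hom C x y" "g \<in> hom C x y" and eq: "amap K f = amap K g"
  shows "f = g"
proof -
  interpret natural_iso C C id_func K t by fact
  note xy = F.dom.hom_Obj[OF fg(1)]
  have i: "t y \<in> hom C y (omap K y)" "is_iso C (t y)"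
    using component invertible xy by auto
  have "t y \<cdot>\<^bsub>C\<^esub> f = t y \<cdot>\<^bsub>C\<^esub> g"
    using naturality[OF fg(1)] naturality[OF fg(2)] eq by simp
  then show ?thesis
    using F.dom.Comp_inv_cancel(2)[OF i fg(1)] F.dom.Comp_inv_cancel(2)[OF i fg(2)] by metis
qed

locale equivalence_data = E: cat_functor C D E + G: cat_functor D C G
  + t: natural_iso C C id_func "G \<circ>\<^sub>F E" t + u: natural_iso D D "E \<circ>\<^sub>F G" id_func u
  for C :: "('o, 'a) cat" and D :: "('p, 'b) cat" and E G t u
begin

lemma faithful:
  assumes "f \<in> hom C x y" "g \<in> hom C x y" "amap E f = amap E g"
  shows "f = g"
  using natural_iso_id_faithful[OF t.natural_iso_axioms assms(1,2)] assms(3) by simp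

lemma inverse_faithful:
  assumes "f \<in> hom D x y" "g \<in> hom D x y" "amap G f = amap G g"
  shows "f = g"
  using natural_iso_id_faithful[OF natural_iso_inverse[OF u.natural_iso_axioms] assms(1,2)] assms(3)
  by simp

text \<open>The preimage of \<open>g\<close> is \<open>G g\<close> conjugated by \<open>t\<close>. Its image under \<open>E\<close> is \<open>g\<close> because both have the
  same image under \<open>G\<close>, which is faithful too.\<close>

lemma full:
  assumes x: "x \<in> Obj C" and y: "y \<in> Obj C" and g: "g \<in> hom D (omap E x) (omap E y)"
  obtains f where "f \<in> hom C x y" "amap E f = g"
proof -
  have tx: "t x \<in> hom C x (omap G (omap E x))" "is_iso C (t x)"
    and ty: "t y \<in> hom C y (omap G (omap E y))" "is_iso C (t y)"
    using t.component t.invertible x y by auto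
  note Gg = G.amap_closed[OF g]
  define f where "f = inv_arr C (t y) \<cdot>\<^bsub>C\<^esub> (amap G g \<cdot>\<^bsub>C\<^esub> t x)"
  have f: "f \<in> hom C x y"
    unfolding f_def
    using E.dom.Comp_closed[OF E.dom.Comp_closed[OF tx(1) Gg] E.dom.inv_arr(1)[OF ty]] .
  have "amap G (amap E f) \<cdot>\<^bsub>C\<^esub> t x = amap G g \<cdot>\<^bsub>C\<^esub> t x"
    using t.naturality[OF f] E.dom.Comp_inv_cancel(1)[OF ty E.dom.Comp_closed[OF tx(1) Gg]]
    by (simp add: f_def)
  then have "amap G (amap E f) = amap G g"
    using E.dom.Comp_inv_cancel(3)[OF tx Gg]
      E.dom.Comp_inv_cancel(3)[OF tx G.amap_closed[OF E.amap_closed[OF f]]] by metis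
  then show ?thesis
    using that[OF f] inverse_faithful[OF E.amap_closed[OF f] g] by blast
qed

text \<open>\<open>E\<close> is full and faithful, so it is bijective on cones with a given vertex in its domain. Only
  that vertex has to be provided; \<open>G\<close> supplies one up to isomorphism.\<close>

lemma lift_cone:
  assumes J: "cat_functor S C J" and c: "c \<in> Obj C"
    and \<sigma>: "cone S D (E \<circ>\<^sub>F J) (omap E c) \<sigma>"
  obtains \<tau> where "cone S C J c \<tau>" "\<And>s. s \<in> Obj S \<Longrightarrow> amap E (\<tau> s) = \<sigma> s"
proof -
  interpret J: diagram S C J unfolding diagram_def by fact
  have "\<exists>f. f \<in> hom C c (omap J s) \<and> amap E f = \<sigma> s" if "s \<in> Obj S" for s
    using full[OF c J.omap_closed[OF that]] cone_arr[OF \<sigma> that] by (metis comp_func_simps(1))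
  then obtain \<tau> where \<tau>: "\<And>s. s \<in> Obj S \<Longrightarrow> \<tau> s \<in> hom C c (omap J s)"
    and E\<tau>: "\<And>s. s \<in> Obj S \<Longrightarrow> amap E (\<tau> s) = \<sigma> s"
    by metis
  have "amap J f \<cdot>\<^bsub>C\<^esub> \<tau> (Dom S f) = \<tau> (Cod S f)" if f: "f \<in> Arr S" for f
  proof (rule faithful)
    note s = J.dom.Dom_closed[OF f] J.dom.Cod_closed[OF f] and Jf = J.amap_closed[OF J.dom.Arr_hom[OF f]]
    show "amap J f \<cdot>\<^bsub>C\<^esub> \<tau> (Dom S f) \<in> hom C c (omap J (Cod S f))"
      using E.dom.Comp_closed[OF \<tau>[OF s(1)] Jf] .
    show "\<tau> (Cod S f) \<in> hom C c (omap J (Cod S f))"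
      using \<tau>[OF s(2)] .
    show "amap E (amap J f \<cdot>\<^bsub>C\<^esub> \<tau> (Dom S f)) = amap E (\<tau> (Cod S f))"
      using E.amap_Comp[OF \<tau>[OF s(1)] Jf] E\<tau> s cone_commutes[OF \<sigma> f] by simp
  qed
  then show ?thesis
    using \<tau> E\<tau> c by (intro that[of \<tau>]) (auto simp: cone_def)
qed

lemma reflects_limit_cone:
  assumes J: "cat_functor S C J" and \<tau>: "cone S C J c \<tau>"
    and lim: "limit_cone S D (E \<circ>\<^sub>F J) (omap E c) (\<lambda>s. amap E (\<tau> s))"
  shows "limit_cone S C J c \<tau>"
proof -
  interpret J: diagram S C J unfolding diagram_def by fact
  interpret EJ: diagram S D "E \<circ>\<^sub>F J"
    unfolding diagram_def using J E.cat_functor_axioms by (rule cat_functor_comp)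
  have c: "c \<in> Obj C" using \<tau> by (simp add: cone_def)
  show ?thesis
  proof (rule J.limit_coneI[OF \<tau>])
    fix d \<sigma> assume \<sigma>: "cone S C J d \<sigma>"
    have d: "d \<in> Obj C" using \<sigma> by (simp add: cone_def)
    obtain v where v: "v \<in> hom D (omap E d) (omap E c)"
      "\<And>s. s \<in> Obj S \<Longrightarrow> amap E (\<tau> s) \<cdot>\<^bsub>D\<^esub> v = amap E (\<sigma> s)"
      by (rule limit_cone_factor[OF lim J.cone_image[OF E.cat_functor_axioms \<sigma>]]) blast
    obtain f where f: "f \<in> hom C d c" "amap E f = v"
      by (rule full[OF d c v(1)]) blast
    have "\<tau> s \<cdot>\<^bsub>C\<^esub> f = \<sigma> s" if s: "s \<in> Obj S" for s
      using E.dom.Comp_closed[OF f(1) cone_arr[OF \<tau> s]] cone_arr[OF \<sigma> s]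
        E.amap_Comp[OF f(1) cone_arr[OF \<tau> s]] f(2) v(2)[OF s] by - (rule faithful, auto)
    then show "\<exists>f \<in> hom C d c. \<forall>s \<in> Obj S. \<tau> s \<cdot>\<^bsub>C\<^esub> f = \<sigma> s"
      using f(1) by blast
  next
    fix d f g assume fg: "f \<in> hom C d c" "g \<in> hom C d c"
      and eq: "\<forall>s \<in> Obj S. \<tau> s \<cdot>\<^bsub>C\<^esub> f = \<tau> s \<cdot>\<^bsub>C\<^esub> g"
    have "amap E f = amap E g"
    proof (rule EJ.limit_cone_jointly_monic[OF lim E.amap_closed[OF fg(1)] E.amap_closed[OF fg(2)]])
      fix s assume s: "s \<in> Obj S"
      show "amap E (\<tau> s) \<cdot>\<^bsub>D\<^esub> amap E f = amap E (\<tau> s) \<cdot>\<^bsub>D\<^esub> amap E g"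
        using E.amap_Comp[OF fg(1) cone_arr[OF \<tau> s]] E.amap_Comp[OF fg(2) cone_arr[OF \<tau> s]] eq s
        by simp
    qed
    then show "f = g"
      by (rule faithful[OF fg])
  qed
qed

text \<open>A cone over \<open>E J\<close> at \<open>d\<close> becomes, after composition with the isomorphism \<open>u d : E (G d) \<rightarrow> d\<close>, a
  cone that lifts along \<open>E\<close>; arrows into the vertex are compared in the same way.\<close>

lemma preserves_limit_cone:
  assumes J: "cat_functor S C J" and lim: "limit_cone S C J c \<tau>"
  shows "limit_cone S D (E \<circ>\<^sub>F J) (omap E c) (\<lambda>s. amap E (\<tau> s))"
proof -
  interpret J: diagram S C J unfolding diagram_def by fact
  interpret EJ: diagram S D "E \<circ>\<^sub>F J"
    unfolding diagram_def using J E.cat_functor_axioms by (rule cat_functor_comp)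
  note \<tau> = limit_cone_is_cone[OF lim]
  have c: "c \<in> Obj C" using \<tau> by (simp add: cone_def)
  show ?thesis
  proof (rule EJ.limit_coneI)
    show "cone S D (E \<circ>\<^sub>F J) (omap E c) (\<lambda>s. amap E (\<tau> s))"
      using J.cone_image[OF E.cat_functor_axioms \<tau>] .
  next
    fix d \<sigma> assume \<sigma>: "cone S D (E \<circ>\<^sub>F J) d \<sigma>"
    have d: "d \<in> Obj D" using \<sigma> by (simp add: cone_def)
    have i: "u d \<in> hom D (omap E (omap G d)) d" "is_iso D (u d)"
      using u.component[OF d] u.invertible[OF d] by auto
    obtain \<rho> where \<rho>: "cone S C J (omap G d) \<rho>" "\<And>s. s \<in> Obj S \<Longrightarrow> amap E (\<rho> s) = \<sigma> s \<cdot>\<^bsub>D\<^esub> u d"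
      by (rule lift_cone[OF J G.omap_closed[OF d] EJ.cone_precomp[OF \<sigma> i(1)]]) blast
    obtain f where f: "f \<in> hom C (omap G d) c" "\<And>s. s \<in> Obj S \<Longrightarrow> \<tau> s \<cdot>\<^bsub>C\<^esub> f = \<rho> s"
      by (rule limit_cone_factor[OF lim \<rho>(1)]) blast
    have v: "amap E f \<cdot>\<^bsub>D\<^esub> inv_arr D (u d) \<in> hom D d (omap E c)"
      using E.cod.Comp_closed[OF E.cod.inv_arr(1)[OF i] E.amap_closed[OF f(1)]] .
    have "amap E (\<tau> s) \<cdot>\<^bsub>D\<^esub> (amap E f \<cdot>\<^bsub>D\<^esub> inv_arr D (u d)) = \<sigma> s" if s: "s \<in> Obj S" for s
      using E.cod.Comp_assoc[OF E.cod.inv_arr(1)[OF i] E.amap_closed[OF f(1)] E.amap_closed[OF cone_arr[OF \<tau> s]]]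
        E.amap_Comp[OF f(1) cone_arr[OF \<tau> s]] f(2)[OF s] \<rho>(2)[OF s]
        E.cod.Comp_inv_cancel(3)[OF i cone_arr[OF \<sigma> s]] by simp
    then show "\<exists>v \<in> hom D d (omap E c). \<forall>s \<in> Obj S. amap E (\<tau> s) \<cdot>\<^bsub>D\<^esub> v = \<sigma> s"
      using v by blast
  next
    fix d v w assume vw: "v \<in> hom D d (omap E c)" "w \<in> hom D d (omap E c)"
      and eq: "\<forall>s \<in> Obj S. amap E (\<tau> s) \<cdot>\<^bsub>D\<^esub> v = amap E (\<tau> s) \<cdot>\<^bsub>D\<^esub> w"
    have d: "d \<in> Obj D" using E.cod.hom_Obj[OF vw(1)] by simp
    have i: "u d \<in> hom D (omap E (omap G d)) d" "is_iso D (u d)"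
      using u.component[OF d] u.invertible[OF d] by auto
    obtain f where f: "f \<in> hom C (omap G d) c" "amap E f = v \<cdot>\<^bsub>D\<^esub> u d"
      by (rule full[OF G.omap_closed[OF d] c E.cod.Comp_closed[OF i(1) vw(1)]]) blast
    obtain g where g: "g \<in> hom C (omap G d) c" "amap E g = w \<cdot>\<^bsub>D\<^esub> u d"
      by (rule full[OF G.omap_closed[OF d] c E.cod.Comp_closed[OF i(1) vw(2)]]) blast
    have "f = g"
    proof (rule J.limit_cone_jointly_monic[OF lim f(1) g(1)])
      fix s assume s: "s \<in> Obj S"
      note \<tau>s = cone_arr[OF \<tau> s]
      show "\<tau> s \<cdot>\<^bsub>C\<^esub> f = \<tau> s \<cdot>\<^bsub>C\<^esub> g"
      proof (rule faithful[OF E.dom.Comp_closed[OF f(1) \<tau>s] E.dom.Comp_closed[OF g(1) \<tau>s]])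
        show "amap E (\<tau> s \<cdot>\<^bsub>C\<^esub> f) = amap E (\<tau> s \<cdot>\<^bsub>C\<^esub> g)"
          using E.amap_Comp[OF f(1) \<tau>s] E.amap_Comp[OF g(1) \<tau>s] f(2) g(2) eq s
            E.cod.Comp_assoc[OF i(1) vw(1) E.amap_closed[OF \<tau>s]]
            E.cod.Comp_assoc[OF i(1) vw(2) E.amap_closed[OF \<tau>s]] by simp
      qed
    qed
    then show "v = w"
      using f(2) g(2) E.cod.Comp_inv_cancel(3)[OF i vw(1)] E.cod.Comp_inv_cancel(3)[OF i vw(2)]
      by metis
  qed
qed

lemma lifts_has_limit:
  assumes J: "cat_functor S C J" and "has_limit S D (E \<circ>\<^sub>F J)"
  shows "has_limit S C J"
proof -
  interpret J: diagram S C J unfolding diagram_def by fact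
  interpret EJ: diagram S D "E \<circ>\<^sub>F J"
    unfolding diagram_def using J E.cat_functor_axioms by (rule cat_functor_comp)
  obtain d \<sigma> where \<sigma>: "limit_cone S D (E \<circ>\<^sub>F J) d \<sigma>"
    using assms(2) by (auto simp: has_limit_def)
  have d: "d \<in> Obj D" using \<sigma> by (simp add: limit_cone_def cone_def)
  have i: "u d \<in> hom D (omap E (omap G d)) d" "is_iso D (u d)"
    using u.component[OF d] u.invertible[OF d] by auto
  note lim = EJ.limit_cone_precomp_iso[OF \<sigma> i]
  obtain \<rho> where \<rho>: "cone S C J (omap G d) \<rho>" "\<And>s. s \<in> Obj S \<Longrightarrow> amap E (\<rho> s) = \<sigma> s \<cdot>\<^bsub>D\<^esub> u d"
    by (rule lift_cone[OF J G.omap_closed[OF d] limit_cone_is_cone[OF lim]]) blast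
  have "limit_cone S D (E \<circ>\<^sub>F J) (omap E (omap G d)) (\<lambda>s. amap E (\<rho> s))"
    using lim limit_cone_cong[OF J.dom.category_axioms, of "E \<circ>\<^sub>F J" "E \<circ>\<^sub>F J"
        "\<lambda>s. amap E (\<rho> s)" "\<lambda>s. \<sigma> s \<cdot>\<^bsub>D\<^esub> u d"] \<rho>(2) by simp
  then show ?thesis
    using reflects_limit_cone[OF J \<rho>(1)] by (auto simp: has_limit_def)
qed

text \<open>Any \<open>H\<close> on the domain of \<open>E\<close> is isomorphic to \<open>(H G) E\<close>, and \<open>H G\<close> preserves the limit of \<open>E J\<close>
  by hypothesis. As \<open>H G\<close> has the same codomain as \<open>H\<close>, the universe \<open>U\<close> does not change, even
  when the domain and the codomain of \<open>E\<close> live in different types.\<close>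

lemma lifts_absolute_limit:
  fixes U :: "('q, 'c) cat itself"
  assumes J: "cat_functor S C J" and abs: "absolute_limit U S D (E \<circ>\<^sub>F J)"
  shows "absolute_limit U S C J"
  unfolding absolute_limit_def preserves_limit_def
proof (intro allI impI)
  fix X :: "('q, 'c) cat" and H c \<tau>
  assume H: "cat_functor C X H" and lim: "limit_cone S C J c \<tau>"
  have "limit_cone S X ((H \<circ>\<^sub>F G) \<circ>\<^sub>F (E \<circ>\<^sub>F J)) (omap (H \<circ>\<^sub>F G) (omap E c))
      (\<lambda>s. amap (H \<circ>\<^sub>F G) (amap E (\<tau> s)))"
    using abs cat_functor_comp[OF G.cat_functor_axioms H] preserves_limit_cone[OF J lim]
    unfolding absolute_limit_def preserves_limit_def by blast
  then have "limit_cone S X ((H \<circ>\<^sub>F (G \<circ>\<^sub>F E)) \<circ>\<^sub>F J) (omap (H \<circ>\<^sub>F (G \<circ>\<^sub>F E)) c)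
      (\<lambda>s. amap (H \<circ>\<^sub>F (G \<circ>\<^sub>F E)) (\<tau> s))"
    by (simp add: comp_func_assoc)
  moreover have "natural_iso C X (H \<circ>\<^sub>F (G \<circ>\<^sub>F E)) H (\<lambda>x. amap H (inv_arr C (t x)))"
    using natural_iso_whisker_left[OF natural_iso_inverse[OF t.natural_iso_axioms] H]
    by (simp add: comp_func_id)
  ultimately show "limit_cone S X (H \<circ>\<^sub>F J) (omap H c) (\<lambda>s. amap H (\<tau> s))"
    using limit_cone_image_natural_iso[OF _ J limit_cone_is_cone[OF lim]] by blast
qed

end

lemma equivalenceE:
  assumes "equivalence C D E"
  obtains G t u where "equivalence_data C D E G t u"
  using assms unfolding equivalence_def equivalence_data_def by blast

section \<open>Creation of absolute limits and equivalences\<close>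

lemma creates_absolute_limitsD:
  fixes V :: "('s, 't) cat itself" and S :: "('s, 't) cat"
  assumes "creates_absolute_limits V U B C F" "cat_functor S B J"
    and "has_limit S C (F \<circ>\<^sub>F J)" "absolute_limit U S C (F \<circ>\<^sub>F J)"
  shows "\<lbrakk>cone S B J c \<tau>; limit_cone S C (F \<circ>\<^sub>F J) (omap F c) (\<lambda>s. amap F (\<tau> s))\<rbrakk>
      \<Longrightarrow> limit_cone S B J c \<tau>"
    and "has_limit S B J" "preserves_limit S B C F J"
  using assms(1)[unfolded creates_absolute_limits_def, rule_format,
      OF conjI[OF assms(2) conjI[OF assms(3,4)]]]
  by auto

text \<open>\<open>F\<close> and \<open>F'\<close> need only agree on \<open>B\<close>, which contains all values of the diagram and the cones.\<close>

lemma creates_absolute_limits_cong: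
  fixes V :: "('s, 't) cat itself" and U :: "('p, 'b) cat itself"
  assumes eq: "eq_functor B C F F'" and F': "creates_absolute_limits V U B C F'"
  shows "creates_absolute_limits V U B C F"
  unfolding creates_absolute_limits_def
proof (intro allI impI, elim conjE)
  fix S :: "('s, 't) cat" and J
  assume J: "cat_functor S B J" and has: "has_limit S C (F \<circ>\<^sub>F J)"
    and abs: "absolute_limit U S C (F \<circ>\<^sub>F J)"
  interpret J: diagram S B J unfolding diagram_def by fact
  have o: "omap F x = omap F' x" if "x \<in> Obj B" for x
    using eq that by (simp add: eq_functor_def)
  have a: "amap F f = amap F' f" if "f \<in> hom B x y" for f x y
    using eq that by (simp add: eq_functor_def hom_def)
  note oJ = o[OF J.omap_closed] and aJ = a[OF J.amap_closed[OF J.dom.Arr_hom]]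
  have lim: "limit_cone S D (G \<circ>\<^sub>F (F \<circ>\<^sub>F J)) d \<sigma> \<longleftrightarrow> limit_cone S D (G \<circ>\<^sub>F (F' \<circ>\<^sub>F J)) d \<sigma>"
    for D :: "('p, 'b) cat" and G d \<sigma>
    by (intro limit_cone_cong[OF J.dom.category_axioms]) (simp_all add: oJ aJ)
  have lim': "limit_cone S C (F \<circ>\<^sub>F J) d \<sigma> \<longleftrightarrow> limit_cone S C (F' \<circ>\<^sub>F J) d \<sigma>" for d \<sigma>
    by (intro limit_cone_cong[OF J.dom.category_axioms]) (simp_all add: oJ aJ)
  have image: "limit_cone S C (F \<circ>\<^sub>F J) (omap F c) (\<lambda>s. amap F (\<tau> s))
      \<longleftrightarrow> limit_cone S C (F' \<circ>\<^sub>F J) (omap F' c) (\<lambda>s. amap F' (\<tau> s))"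
    if \<tau>: "cone S B J c \<tau>" for c \<tau>
  proof -
    have "omap F c = omap F' c"
      using \<tau> o by (simp add: cone_def)
    then show ?thesis
      by (simp, intro limit_cone_cong[OF J.dom.category_axioms])
        (simp_all add: oJ aJ a[OF cone_arr[OF \<tau>]])
  qed
  have "has_limit S C (F' \<circ>\<^sub>F J)"
    using has lim' by (simp add: has_limit_def)
  moreover have "absolute_limit U S C (F' \<circ>\<^sub>F J)"
    using abs lim lim' by (simp add: absolute_limit_def preserves_limit_def)
  ultimately have *: "\<lbrakk>cone S B J c \<tau>;
        limit_cone S C (F' \<circ>\<^sub>F J) (omap F' c) (\<lambda>s. amap F' (\<tau> s))\<rbrakk> \<Longrightarrow> limit_cone S B J c \<tau>"
    "has_limit S B J" "preserves_limit S B C F' J" for c \<tau>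
    using creates_absolute_limitsD[OF F' J] by blast+
  have "preserves_limit S B C F J"
    using *(3) image[OF limit_cone_is_cone] by (simp add: preserves_limit_def)
  then show "(\<forall>c \<tau>. cone S B J c \<tau> \<and> limit_cone S C (F \<circ>\<^sub>F J) (omap F c) (\<lambda>s. amap F (\<tau> s))
      \<longrightarrow> limit_cone S B J c \<tau>) \<and> has_limit S B J \<and> preserves_limit S B C F J"
    using *(1,2) image by blast
qed

lemma creates_absolute_limits_postcomp_equivalence:
  fixes V :: "('s, 't) cat itself"
  assumes F: "cat_functor B C F" and create: "creates_absolute_limits V U B C F"
    and "equivalence C D E"
  shows "creates_absolute_limits V U B D (E \<circ>\<^sub>F F)"
  unfolding creates_absolute_limits_def comp_func_assoc
proof (intro allI impI, elim conjE)
  obtain G t u where "equivalence_data C D E G t u"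
    using assms(3) by (rule equivalenceE)
  then interpret E: equivalence_data C D E G t u .
  fix S :: "('s, 't) cat" and J
  assume J: "cat_functor S B J" and has: "has_limit S D (E \<circ>\<^sub>F (F \<circ>\<^sub>F J))"
    and abs: "absolute_limit U S D (E \<circ>\<^sub>F (F \<circ>\<^sub>F J))"
  interpret J: diagram S B J unfolding diagram_def by fact
  note FJ = cat_functor_comp[OF J F]
  note * = creates_absolute_limitsD[OF create J E.lifts_has_limit[OF FJ has]
      E.lifts_absolute_limit[OF FJ abs]]
  have "preserves_limit S B D (E \<circ>\<^sub>F F) J"
    using *(3) E.preserves_limit_cone[OF FJ] by (simp add: preserves_limit_def comp_func_assoc)
  then show "(\<forall>c \<tau>. cone S B J c \<tau> \<and> limit_cone S D (E \<circ>\<^sub>F (F \<circ>\<^sub>F J)) (omap (E \<circ>\<^sub>F F) c)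
        (\<lambda>s. amap (E \<circ>\<^sub>F F) (\<tau> s)) \<longrightarrow> limit_cone S B J c \<tau>)
      \<and> has_limit S B J \<and> preserves_limit S B D (E \<circ>\<^sub>F F) J"
    using *(1,2) E.reflects_limit_cone[OF FJ J.cone_image[OF F]] unfolding comp_func_simps by blast
qed

lemma creates_absolute_limits_precomp_equivalence:
  fixes V :: "('s, 't) cat itself"
  assumes F: "cat_functor C D F" and create: "creates_absolute_limits V U C D F"
    and "equivalence B C E"
  shows "creates_absolute_limits V U B D (F \<circ>\<^sub>F E)"
  unfolding creates_absolute_limits_def comp_func_assoc
proof (intro allI impI, elim conjE)
  obtain G t u where "equivalence_data B C E G t u"
    using assms(3) by (rule equivalenceE)
  then interpret E: equivalence_data B C E G t u .
  fix S :: "('s, 't) cat" and J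
  assume J: "cat_functor S B J" and has: "has_limit S D (F \<circ>\<^sub>F (E \<circ>\<^sub>F J))"
    and abs: "absolute_limit U S D (F \<circ>\<^sub>F (E \<circ>\<^sub>F J))"
  interpret J: diagram S B J unfolding diagram_def by fact
  note EJ = cat_functor_comp[OF J E.E.cat_functor_axioms]
  note * = creates_absolute_limitsD[OF create EJ has abs]
  have "limit_cone S B J c \<tau>" if \<tau>: "cone S B J c \<tau>"
    and lim: "limit_cone S D (F \<circ>\<^sub>F (E \<circ>\<^sub>F J)) (omap F (omap E c)) (\<lambda>s. amap F (amap E (\<tau> s)))"
    for c \<tau>
    using E.reflects_limit_cone[OF J \<tau> *(1)[OF J.cone_image[OF E.E.cat_functor_axioms \<tau>] lim]] .
  moreover have "preserves_limit S B D (F \<circ>\<^sub>F E) J"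
    using *(3) E.preserves_limit_cone[OF J] by (simp add: preserves_limit_def comp_func_assoc)
  ultimately show "(\<forall>c \<tau>. cone S B J c \<tau> \<and> limit_cone S D (F \<circ>\<^sub>F (E \<circ>\<^sub>F J)) (omap (F \<circ>\<^sub>F E) c)
        (\<lambda>s. amap (F \<circ>\<^sub>F E) (\<tau> s)) \<longrightarrow> limit_cone S B J c \<tau>)
      \<and> has_limit S B J \<and> preserves_limit S B D (F \<circ>\<^sub>F E) J"
    using E.lifts_has_limit[OF J *(2)] by simp
qed


section \<open>Opposite categories\<close>

lemma op_cat_simps [simp]:
  "Obj (op_cat C) = Obj C" "Arr (op_cat C) = Arr C" "Dom (op_cat C) = Cod C"
  "Cod (op_cat C) = Dom C" "Ide (op_cat C) = Ide C" "g \<cdot>\<^bsub>op_cat C\<^esub> f = f \<cdot>\<^bsub>C\<^esub> g"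
  "hom (op_cat C) x y = hom C y x"
  by (auto simp: op_cat_def hom_def)

lemma is_iso_op [simp]: "is_iso (op_cat C) f \<longleftrightarrow> is_iso C f"
  by (auto simp: is_iso_def inverse_arrows_def)

lemma category_op: "category C \<Longrightarrow> category (op_cat C)"
  unfolding category_def by (simp, metis)

lemma cat_functor_op: "cat_functor C D F \<Longrightarrow> cat_functor (op_cat C) (op_cat D) F"
  unfolding cat_functor_def cat_functor_axioms_def
  by (simp add: category_op) blast

lemma natural_iso_op: "natural_iso C D F G t \<Longrightarrow> natural_iso (op_cat C) (op_cat D) G F t"
  unfolding natural_iso_def natural_iso_axioms_def by (simp add: cat_functor_op)

lemma equivalence_op:
  assumes "equivalence C D E"
  shows "equivalence (op_cat C) (op_cat D) E"
  using assms natural_iso_op[OF natural_iso_inverse] cat_functor_op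
  unfolding equivalence_def by metis

lemma eq_functor_op: "eq_functor C D F G \<Longrightarrow> eq_functor (op_cat C) (op_cat D) F G"
  by (simp add: eq_functor_def cat_functor_op)


section \<open>Dialgebras subject to equations\<close>

text \<open>A dialgebra for functors \<open>a\<close>, \<open>b\<close> from \<open>X\<close> to \<open>Y\<close> is an object \<open>w\<close> of \<open>X\<close> with an arrow
  \<open>\<phi> : a w \<rightarrow> b w\<close>. A term assigns to each dialgebra an arrow \<open>H w \<rightarrow> K w\<close>, naturally in morphisms
  of dialgebras: it is a natural transformation from \<open>H\<close> to \<open>K\<close>, both restricted along the
  forgetful functor. Both sides of each descent equation are of this kind.\<close>

definition dialgebra_term ::
  "('o, 'a) cat \<Rightarrow> ('o, 'a) cat \<Rightarrow> ('o, 'a, 'o, 'a) func \<Rightarrow> ('o, 'a, 'o, 'a) func \<Rightarrow>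
   ('o, 'a) cat \<Rightarrow> ('o, 'a, 'o, 'a) func \<Rightarrow> ('o, 'a, 'o, 'a) func \<Rightarrow> ('o \<Rightarrow> 'a \<Rightarrow> 'a) \<Rightarrow> bool" where
  "dialgebra_term X Y a b Z H K P \<longleftrightarrow>
     (\<forall>w \<in> Obj X. \<forall>\<phi> \<in> hom Y (omap a w) (omap b w). P w \<phi> \<in> hom Z (omap H w) (omap K w))
   \<and> (\<forall>w w' m \<phi> \<phi>'. m \<in> hom X w w' \<and> \<phi> \<in> hom Y (omap a w) (omap b w)
        \<and> \<phi>' \<in> hom Y (omap a w') (omap b w') \<and> amap b m \<cdot>\<^bsub>Y\<^esub> \<phi> = \<phi>' \<cdot>\<^bsub>Y\<^esub> amap a m
        \<longrightarrow> amap K m \<cdot>\<^bsub>Z\<^esub> P w \<phi> = P w' \<phi>' \<cdot>\<^bsub>Z\<^esub> amap H m)"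

lemma dialgebra_term_op:
  assumes "dialgebra_term X Y a b Z H K P"
  shows "dialgebra_term (op_cat X) (op_cat Y) b a (op_cat Z) K H P"
  using assms unfolding dialgebra_term_def op_cat_simps by metis

lemma dialgebra_term_natural:
  assumes "natural_iso X Z H K t"
  shows "dialgebra_term X Y a b Z H K (\<lambda>w \<phi>. t w)"
proof -
  interpret t: natural_iso X Z H K t by fact
  show ?thesis
    unfolding dialgebra_term_def using t.component t.naturality by blast
qed

lemma dialgebra_term_image:
  assumes "cat_functor X Y a" "cat_functor X Y b" "cat_functor Y Z D"
  shows "dialgebra_term X Y a b Z (D \<circ>\<^sub>F a) (D \<circ>\<^sub>F b) (\<lambda>w. amap D)"
proof -
  interpret a: cat_functor X Y a by fact
  interpret b: cat_functor X Y b by fact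
  interpret D: cat_functor Y Z D by fact
  show ?thesis
    unfolding dialgebra_term_def
  proof (intro conjI ballI allI impI, goal_cases)
    case 1
    then show ?case by (simp add: D.amap_closed)
  next
    case (2 w w' m \<phi> \<phi>')
    then show ?case
      using D.amap_Comp[OF _ b.amap_closed, of \<phi> _ w m w'] D.amap_Comp[OF a.amap_closed, of m w w' \<phi>']
      by auto
  qed
qed

lemma dialgebra_term_comp:
  assumes "cat_functor X Z H" "cat_functor X Z G" "cat_functor X Z K"
    and P: "dialgebra_term X Y a b Z H G P" and Q: "dialgebra_term X Y a b Z G K Q"
  shows "dialgebra_term X Y a b Z H K (\<lambda>w \<phi>. Q w \<phi> \<cdot>\<^bsub>Z\<^esub> P w \<phi>)"
proof -
  interpret H: cat_functor X Z H by fact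
  interpret G: cat_functor X Z G by fact
  interpret K: cat_functor X Z K by fact
  show ?thesis
    unfolding dialgebra_term_def
  proof (intro conjI ballI allI impI, goal_cases)
    case (1 w \<phi>)
    then show ?case
      using P Q H.cod.Comp_closed unfolding dialgebra_term_def by blast
  next
    case (2 w w' m \<phi> \<phi>')
    have w: "w \<in> Obj X" "w' \<in> Obj X"
      using 2 H.dom.hom_Obj by blast+
    show ?case
    proof (rule H.cod.paste)
      show "P w \<phi> \<in> hom Z (omap H w) (omap G w)" "P w' \<phi>' \<in> hom Z (omap H w') (omap G w')"
        "Q w \<phi> \<in> hom Z (omap G w) (omap K w)" "Q w' \<phi>' \<in> hom Z (omap G w') (omap K w')"
        using 2 w P Q unfolding dialgebra_term_def by blast+
      show "amap H m \<in> hom Z (omap H w) (omap H w')" "amap G m \<in> hom Z (omap G w) (omap G w')"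
        "amap K m \<in> hom Z (omap K w) (omap K w')"
        using 2 H.amap_closed G.amap_closed K.amap_closed by blast+
      show "amap G m \<cdot>\<^bsub>Z\<^esub> P w \<phi> = P w' \<phi>' \<cdot>\<^bsub>Z\<^esub> amap H m"
        "amap K m \<cdot>\<^bsub>Z\<^esub> Q w \<phi> = Q w' \<phi>' \<cdot>\<^bsub>Z\<^esub> amap G m"
        using 2 P Q unfolding dialgebra_term_def by blast+
    qed
  qed
qed

text \<open>\<open>L\<close> is the category of those dialgebras that satisfy the equations \<open>P i = Q i\<close>, with forgetful
  functor \<open>U\<close> and structure arrows \<open>str\<close>. It is characterised through \<open>U\<close> and \<open>str\<close> rather than
  constructed, so that the opposite of an instance is again an instance on the nose. All the
  categories \<open>X\<close>, \<open>Y\<close> and \<open>Z i\<close> live in the same universe, hence \<open>b\<close> and each \<open>K i\<close> are among the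
  functors that preserve an absolute limit in \<open>X\<close>.\<close>

locale equational_dialgebras =
  U: cat_functor L X U + a: cat_functor X Y a + b: cat_functor X Y b
  for L :: "('l, 'm) cat" and X Y :: "('o, 'a) cat" and U a b +
  fixes str :: "'l \<Rightarrow> 'a"
    and Z :: "'i \<Rightarrow> ('o, 'a) cat" and H K :: "'i \<Rightarrow> ('o, 'a, 'o, 'a) func"
    and P Q :: "'i \<Rightarrow> 'o \<Rightarrow> 'a \<Rightarrow> 'a"
  assumes str_hom: "p \<in> Obj L \<Longrightarrow> str p \<in> hom Y (omap a (omap U p)) (omap b (omap U p))"
    and U_morphism: "f \<in> hom L p q \<Longrightarrow>
      amap b (amap U f) \<cdot>\<^bsub>Y\<^esub> str p = str q \<cdot>\<^bsub>Y\<^esub> amap a (amap U f)"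
    and U_faithful: "\<lbrakk>f \<in> hom L p q; g \<in> hom L p q; amap U f = amap U g\<rbrakk> \<Longrightarrow> f = g"
    and U_full: "\<lbrakk>p \<in> Obj L; q \<in> Obj L; m \<in> hom X (omap U p) (omap U q);
      amap b m \<cdot>\<^bsub>Y\<^esub> str p = str q \<cdot>\<^bsub>Y\<^esub> amap a m\<rbrakk> \<Longrightarrow> \<exists>f \<in> hom L p q. amap U f = m"
    and H_functor: "cat_functor X (Z i) (H i)" and K_functor: "cat_functor X (Z i) (K i)"
    and P_term: "dialgebra_term X Y a b (Z i) (H i) (K i) (P i)"
    and Q_term: "dialgebra_term X Y a b (Z i) (H i) (K i) (Q i)"
    and equations: "p \<in> Obj L \<Longrightarrow> P i (omap U p) (str p) = Q i (omap U p) (str p)"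
    and all_solutions: "\<lbrakk>w \<in> Obj X; \<phi> \<in> hom Y (omap a w) (omap b w);
      \<And>i. P i w \<phi> = Q i w \<phi>\<rbrakk> \<Longrightarrow> \<exists>p \<in> Obj L. omap U p = w \<and> str p = \<phi>"
begin

lemma opposite:
  "equational_dialgebras (op_cat L) (op_cat X) (op_cat Y) U b a str (\<lambda>i. op_cat (Z i)) K H P Q"
proof (intro equational_dialgebras.intro equational_dialgebras_axioms.intro)
  show "cat_functor (op_cat L) (op_cat X) U" "cat_functor (op_cat X) (op_cat Y) a"
    "cat_functor (op_cat X) (op_cat Y) b" "cat_functor (op_cat X) (op_cat (Z i)) (H i)"
    "cat_functor (op_cat X) (op_cat (Z i)) (K i)" for i
    using cat_functor_op H_functor K_functor
      U.cat_functor_axioms a.cat_functor_axioms b.cat_functor_axioms by blast+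
  show "dialgebra_term (op_cat X) (op_cat Y) b a (op_cat (Z i)) (K i) (H i) (P i)"
    "dialgebra_term (op_cat X) (op_cat Y) b a (op_cat (Z i)) (K i) (H i) (Q i)" for i
    using dialgebra_term_op P_term Q_term by blast+
qed (use str_hom U_morphism U_faithful U_full equations all_solutions in \<open>simp_all\<close>)

text \<open>The comparison arrow \<open>m\<close> in \<open>X\<close> is a morphism of dialgebras: the two sides of the required
  equation are arrows into \<open>b (U c)\<close>, and the projections \<open>b (U (\<tau> s))\<close> of a limit cone do not
  distinguish them.\<close>

lemma reflects_limit_cone:
  assumes J: "cat_functor S L J" and \<tau>: "cone S L J c \<tau>"
    and lim: "limit_cone S X (U \<circ>\<^sub>F J) (omap U c) (\<lambda>s. amap U (\<tau> s))"
    and blim: "preserves_limit S X Y b (U \<circ>\<^sub>F J)"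
  shows "limit_cone S L J c \<tau>"
proof -
  interpret J: diagram S L J unfolding diagram_def by fact
  note UJ_functor = cat_functor_comp[OF J U.cat_functor_axioms]
  interpret UJ: diagram S X "U \<circ>\<^sub>F J"
    unfolding diagram_def by (rule UJ_functor)
  interpret bUJ: diagram S Y "b \<circ>\<^sub>F (U \<circ>\<^sub>F J)"
    unfolding diagram_def using cat_functor_comp[OF UJ_functor b.cat_functor_axioms] .
  have blim: "limit_cone S Y (b \<circ>\<^sub>F (U \<circ>\<^sub>F J)) (omap b (omap U c)) (\<lambda>s. amap b (amap U (\<tau> s)))"
    using blim lim by (simp add: preserves_limit_def)
  have c: "c \<in> Obj L" using \<tau> by (simp add: cone_def)
  show ?thesis
  proof (rule J.limit_coneI[OF \<tau>])
    fix d \<sigma> assume \<sigma>: "cone S L J d \<sigma>"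
    have d: "d \<in> Obj L" using \<sigma> by (simp add: cone_def)
    obtain m where m: "m \<in> hom X (omap U d) (omap U c)"
      and m_eq: "\<And>s. s \<in> Obj S \<Longrightarrow> amap U (\<tau> s) \<cdot>\<^bsub>X\<^esub> m = amap U (\<sigma> s)"
      by (rule limit_cone_factor[OF lim J.cone_image[OF U.cat_functor_axioms \<sigma>]]) blast
    have "amap b m \<cdot>\<^bsub>Y\<^esub> str d = str c \<cdot>\<^bsub>Y\<^esub> amap a m"
    proof (rule bUJ.limit_cone_jointly_monic[OF blim])
      show "amap b m \<cdot>\<^bsub>Y\<^esub> str d \<in> hom Y (omap a (omap U d)) (omap b (omap U c))"
        using a.cod.Comp_closed[OF str_hom[OF d] b.amap_closed[OF m]] .
      show "str c \<cdot>\<^bsub>Y\<^esub> amap a m \<in> hom Y (omap a (omap U d)) (omap b (omap U c))"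
        using a.cod.Comp_closed[OF a.amap_closed[OF m] str_hom[OF c]] .
      fix s assume s: "s \<in> Obj S"
      note \<tau>s = cone_arr[OF \<tau> s] and \<sigma>s = cone_arr[OF \<sigma> s] and Js = J.omap_closed[OF s]
      note U\<tau> = U.amap_closed[OF \<tau>s]
      have "amap b (amap U (\<tau> s)) \<cdot>\<^bsub>Y\<^esub> (amap b m \<cdot>\<^bsub>Y\<^esub> str d) = amap b (amap U (\<sigma> s)) \<cdot>\<^bsub>Y\<^esub> str d"
        using a.cod.Comp_assoc[OF str_hom[OF d] b.amap_closed[OF m] b.amap_closed[OF U\<tau>]]
          b.amap_Comp[OF m U\<tau>] m_eq[OF s] by simp
      also have "\<dots> = str (omap J s) \<cdot>\<^bsub>Y\<^esub> (amap a (amap U (\<tau> s)) \<cdot>\<^bsub>Y\<^esub> amap a m)"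
        using U_morphism[OF \<sigma>s] a.amap_Comp[OF m U\<tau>] m_eq[OF s] by simp
      also have "\<dots> = amap b (amap U (\<tau> s)) \<cdot>\<^bsub>Y\<^esub> (str c \<cdot>\<^bsub>Y\<^esub> amap a m)"
        using a.cod.Comp_assoc[OF a.amap_closed[OF m] a.amap_closed[OF U\<tau>] str_hom[OF Js]]
          a.cod.Comp_assoc[OF a.amap_closed[OF m] str_hom[OF c] b.amap_closed[OF U\<tau>]]
          U_morphism[OF \<tau>s] by simp
      finally show "amap b (amap U (\<tau> s)) \<cdot>\<^bsub>Y\<^esub> (amap b m \<cdot>\<^bsub>Y\<^esub> str d)
          = amap b (amap U (\<tau> s)) \<cdot>\<^bsub>Y\<^esub> (str c \<cdot>\<^bsub>Y\<^esub> amap a m)" .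
    qed
    then obtain f where f: "f \<in> hom L d c" "amap U f = m"
      using U_full[OF d c m] by blast
    have "\<tau> s \<cdot>\<^bsub>L\<^esub> f = \<sigma> s" if s: "s \<in> Obj S" for s
      using U.dom.Comp_closed[OF f(1) cone_arr[OF \<tau> s]] cone_arr[OF \<sigma> s]
        U.amap_Comp[OF f(1) cone_arr[OF \<tau> s]] f(2) m_eq[OF s] by - (rule U_faithful, auto)
    then show "\<exists>f \<in> hom L d c. \<forall>s \<in> Obj S. \<tau> s \<cdot>\<^bsub>L\<^esub> f = \<sigma> s"
      using f(1) by blast
  next
    fix d f g assume fg: "f \<in> hom L d c" "g \<in> hom L d c"
      and eq: "\<forall>s \<in> Obj S. \<tau> s \<cdot>\<^bsub>L\<^esub> f = \<tau> s \<cdot>\<^bsub>L\<^esub> g"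
    have "amap U f = amap U g"
    proof (rule UJ.limit_cone_jointly_monic[OF lim U.amap_closed[OF fg(1)] U.amap_closed[OF fg(2)]])
      fix s assume s: "s \<in> Obj S"
      show "amap U (\<tau> s) \<cdot>\<^bsub>X\<^esub> amap U f = amap U (\<tau> s) \<cdot>\<^bsub>X\<^esub> amap U g"
        using U.amap_Comp[OF fg(1) cone_arr[OF \<tau> s]] U.amap_Comp[OF fg(2) cone_arr[OF \<tau> s]] eq s
        by simp
    qed
    then show "f = g"
      by (rule U_faithful[OF fg])
  qed
qed

lemma lifts_limit_cone:
  assumes J: "cat_functor S L J" and lim: "limit_cone S X (U \<circ>\<^sub>F J) l \<tau>"
    and abs: "absolute_limit TYPE(('o, 'a) cat) S X (U \<circ>\<^sub>F J)"
  obtains p \<rho> where "limit_cone S L J p \<rho>" "omap U p = l" "\<And>s. s \<in> Obj S \<Longrightarrow> amap U (\<rho> s) = \<tau> s"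
proof -
  interpret J: diagram S L J unfolding diagram_def by fact
  note UJ_functor = cat_functor_comp[OF J U.cat_functor_axioms]
  interpret UJ: diagram S X "U \<circ>\<^sub>F J"
    unfolding diagram_def by (rule UJ_functor)
  have preserved: "preserves_limit S X D G (U \<circ>\<^sub>F J)" if "cat_functor X D G" for D :: "('o, 'a) cat" and G
    using abs that by (simp add: absolute_limit_def)
  note cone = limit_cone_is_cone[OF lim]
  have l: "l \<in> Obj X" using cone by (simp add: cone_def)
  have \<tau>: "\<tau> s \<in> hom X l (omap U (omap J s))" if "s \<in> Obj S" for s
    using cone_arr[OF cone that] by simp

  have blim: "limit_cone S Y (b \<circ>\<^sub>F (U \<circ>\<^sub>F J)) (omap b l) (\<lambda>s. amap b (\<tau> s))"
    using preserved[OF b.cat_functor_axioms] lim by (simp add: preserves_limit_def)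
  \<comment> \<open>The structure arrow of the limit is induced by those of the objects \<open>J s\<close>.\<close>
  have "cone S Y (b \<circ>\<^sub>F (U \<circ>\<^sub>F J)) (omap a l) (\<lambda>s. str (omap J s) \<cdot>\<^bsub>Y\<^esub> amap a (\<tau> s))"
    unfolding cone_def
  proof (intro conjI ballI)
    show "omap a l \<in> Obj Y" by (rule a.omap_closed[OF l])
    show "str (omap J s) \<cdot>\<^bsub>Y\<^esub> amap a (\<tau> s) \<in> hom Y (omap a l) (omap (b \<circ>\<^sub>F (U \<circ>\<^sub>F J)) s)"
      if s: "s \<in> Obj S" for s
      using a.cod.Comp_closed[OF a.amap_closed[OF \<tau>[OF s]] str_hom[OF J.omap_closed[OF s]]] by simp
    fix f assume f: "f \<in> Arr S"
    define x y where "x = Dom S f" and "y = Cod S f"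
    have xy: "x \<in> Obj S" "y \<in> Obj S" and f': "f \<in> hom S x y"
      using J.dom.Dom_closed J.dom.Cod_closed J.dom.Arr_hom f by (simp_all add: x_def y_def)
    note Jf = J.amap_closed[OF f'] and a\<tau> = a.amap_closed[OF \<tau>[OF xy(1)]]
    note UJf = U.amap_closed[OF Jf] and strx = str_hom[OF J.omap_closed[OF xy(1)]]
      and stry = str_hom[OF J.omap_closed[OF xy(2)]]
    have "amap b (amap U (amap J f)) \<cdot>\<^bsub>Y\<^esub> (str (omap J x) \<cdot>\<^bsub>Y\<^esub> amap a (\<tau> x))
        = (str (omap J y) \<cdot>\<^bsub>Y\<^esub> amap a (amap U (amap J f))) \<cdot>\<^bsub>Y\<^esub> amap a (\<tau> x)"
      using a.cod.Comp_assoc[OF a\<tau> strx b.amap_closed[OF UJf]] U_morphism[OF Jf] by simp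
    also have "\<dots> = str (omap J y) \<cdot>\<^bsub>Y\<^esub> amap a (\<tau> y)"
      using a.cod.Comp_assoc[OF a\<tau> a.amap_closed[OF UJf] stry] a.amap_Comp[OF \<tau>[OF xy(1)] UJf]
        cone_commutes[OF cone f] by (simp add: x_def y_def)
    finally show "amap (b \<circ>\<^sub>F (U \<circ>\<^sub>F J)) f \<cdot>\<^bsub>Y\<^esub> (str (omap J (Dom S f)) \<cdot>\<^bsub>Y\<^esub> amap a (\<tau> (Dom S f)))
        = str (omap J (Cod S f)) \<cdot>\<^bsub>Y\<^esub> amap a (\<tau> (Cod S f))"
      by (simp add: x_def y_def)
  qed
  then obtain \<phi> where \<phi>: "\<phi> \<in> hom Y (omap a l) (omap b l)"
    and \<tau>_morphism: "\<And>s. s \<in> Obj S \<Longrightarrow> amap b (\<tau> s) \<cdot>\<^bsub>Y\<^esub> \<phi> = str (omap J s) \<cdot>\<^bsub>Y\<^esub> amap a (\<tau> s)"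
    by (rule limit_cone_factor[OF blim]) blast

  \<comment> \<open>The equations hold at \<open>l\<close> because they hold at each \<open>J s\<close> and the \<open>K (\<tau> s)\<close> are jointly monic.\<close>
  have "P i l \<phi> = Q i l \<phi>" for i
  proof -
    interpret KUJ: diagram S "Z i" "K i \<circ>\<^sub>F (U \<circ>\<^sub>F J)"
      unfolding diagram_def using cat_functor_comp[OF UJ_functor K_functor] .
    have Klim: "limit_cone S (Z i) (K i \<circ>\<^sub>F (U \<circ>\<^sub>F J)) (omap (K i) l) (\<lambda>s. amap (K i) (\<tau> s))"
      using preserved[OF K_functor] lim by (simp add: preserves_limit_def)
    \<comment> \<open>Naturality of a term at \<open>\<tau> s\<close> expresses its value at \<open>l\<close> through its value at \<open>J s\<close>.\<close>
    have *: "R l \<phi> \<in> hom (Z i) (omap (H i) l) (omap (K i) l)"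
      "s \<in> Obj S \<Longrightarrow> amap (K i) (\<tau> s) \<cdot>\<^bsub>Z i\<^esub> R l \<phi>
        = R (omap U (omap J s)) (str (omap J s)) \<cdot>\<^bsub>Z i\<^esub> amap (H i) (\<tau> s)"
      if "dialgebra_term X Y a b (Z i) (H i) (K i) R" for R s
      using that l \<phi> \<tau> \<tau>_morphism str_hom[OF J.omap_closed] unfolding dialgebra_term_def by blast+
    show ?thesis
      using *[OF P_term] *[OF Q_term] equations[OF J.omap_closed]
      by - (rule KUJ.limit_cone_jointly_monic[OF Klim], auto)
  qed
  then obtain p where p: "p \<in> Obj L" "omap U p = l" "str p = \<phi>"
    using all_solutions[OF l \<phi>] by blast

  have "\<exists>f. f \<in> hom L p (omap J s) \<and> amap U f = \<tau> s" if s: "s \<in> Obj S" for s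
    using U_full[OF p(1) J.omap_closed[OF s]] \<tau>[OF s] \<tau>_morphism[OF s] p by auto
  then obtain \<rho> where \<rho>: "\<And>s. s \<in> Obj S \<Longrightarrow> \<rho> s \<in> hom L p (omap J s)"
    and U\<rho>: "\<And>s. s \<in> Obj S \<Longrightarrow> amap U (\<rho> s) = \<tau> s"
    by metis
  have "amap J f \<cdot>\<^bsub>L\<^esub> \<rho> (Dom S f) = \<rho> (Cod S f)" if f: "f \<in> Arr S" for f
  proof (rule U_faithful)
    note s = J.dom.Dom_closed[OF f] J.dom.Cod_closed[OF f] and Jf = J.amap_closed[OF J.dom.Arr_hom[OF f]]
    show "amap J f \<cdot>\<^bsub>L\<^esub> \<rho> (Dom S f) \<in> hom L p (omap J (Cod S f))"
      using U.dom.Comp_closed[OF \<rho>[OF s(1)] Jf] .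
    show "\<rho> (Cod S f) \<in> hom L p (omap J (Cod S f))"
      using \<rho>[OF s(2)] .
    show "amap U (amap J f \<cdot>\<^bsub>L\<^esub> \<rho> (Dom S f)) = amap U (\<rho> (Cod S f))"
      using U.amap_Comp[OF \<rho>[OF s(1)] Jf] U\<rho> s cone_commutes[OF cone f] by simp
  qed
  then have cone\<rho>: "cone S L J p \<rho>"
    using \<rho> p(1) by (simp add: cone_def)
  have "limit_cone S X (U \<circ>\<^sub>F J) (omap U p) (\<lambda>s. amap U (\<rho> s))"
    using limit_cone_cong[OF J.dom.category_axioms, of "U \<circ>\<^sub>F J" "U \<circ>\<^sub>F J" "\<lambda>s. amap U (\<rho> s)" \<tau>]
      lim U\<rho> p(2) by simp
  then have "limit_cone S L J p \<rho>"
    using reflects_limit_cone[OF J cone\<rho> _ preserved[OF b.cat_functor_axioms]] by blast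
  then show ?thesis
    using that p(2) U\<rho> by blast
qed

lemma creates_absolute_limits:
  "creates_absolute_limits TYPE(('s, 't) cat) TYPE(('o, 'a) cat) L X U"
  unfolding creates_absolute_limits_def
proof (intro allI impI, elim conjE)
  fix S :: "('s, 't) cat" and J
  assume J: "cat_functor S L J" and has: "has_limit S X (U \<circ>\<^sub>F J)"
    and abs: "absolute_limit TYPE(('o, 'a) cat) S X (U \<circ>\<^sub>F J)"
  interpret J: diagram S L J unfolding diagram_def by fact
  have blim: "preserves_limit S X Y b (U \<circ>\<^sub>F J)"
    using abs b.cat_functor_axioms by (simp add: absolute_limit_def)
  obtain l \<tau> where lim: "limit_cone S X (U \<circ>\<^sub>F J) l \<tau>"
    using has by (auto simp: has_limit_def)
  obtain p \<rho> where \<rho>: "limit_cone S L J p \<rho>" "omap U p = l" "\<And>s. s \<in> Obj S \<Longrightarrow> amap U (\<rho> s) = \<tau> s"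
    by (rule lifts_limit_cone[OF J lim abs]) blast
  have "limit_cone S X (U \<circ>\<^sub>F J) (omap U p) (\<lambda>s. amap U (\<rho> s))"
    using limit_cone_cong[OF J.dom.category_axioms, of "U \<circ>\<^sub>F J" "U \<circ>\<^sub>F J" "\<lambda>s. amap U (\<rho> s)" \<tau>]
      lim \<rho>(2,3) by simp
  then have "preserves_limit S L X U J"
    by (rule J.preserves_limitI[OF U.cat_functor_axioms \<rho>(1)])
  then show "(\<forall>c \<tau>. cone S L J c \<tau> \<and> limit_cone S X (U \<circ>\<^sub>F J) (omap U c) (\<lambda>s. amap U (\<tau> s))
      \<longrightarrow> limit_cone S L J c \<tau>) \<and> has_limit S L J \<and> preserves_limit S L X U J"
    using reflects_limit_cone[OF J _ _ blim] \<rho>(1) by (auto simp: has_limit_def)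
qed

end


section \<open>The lax descent category\<close>

text \<open>The relations of \<open>\<Delta>\<^sub>3\<close> identify the codomains of the two structure cells that make up each
  \<open>\<sigma>\<close> and each \<open>\<nu>\<close>, so that these are vertical composites of natural isomorphisms.\<close>

lemma descent_cells_natural:
  assumes "pseudofunctor Delta3 A"
  shows "natural_iso (pobj A 1) (pobj A 3) (parr A D1 \<circ>\<^sub>F parr A d0) (parr A D0 \<circ>\<^sub>F parr A d0) (sigma01 A)"
    and "natural_iso (pobj A 1) (pobj A 3) (parr A D2 \<circ>\<^sub>F parr A d0) (parr A D0 \<circ>\<^sub>F parr A d1) (sigma02 A)"
    and "natural_iso (pobj A 1) (pobj A 3) (parr A D2 \<circ>\<^sub>F parr A d1) (parr A D1 \<circ>\<^sub>F parr A d1) (sigma12 A)"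
    and "natural_iso (pobj A 1) (pobj A 1) (parr A s0 \<circ>\<^sub>F parr A d0) id_func (nu0 A)"
    and "natural_iso (pobj A 1) (pobj A 1) (parr A s0 \<circ>\<^sub>F parr A d1) id_func (nu1 A)"
proof -
  note One_nat_def [simp del]
  interpret A: pseudofunctor Delta3 A by fact
  have unit: "natural_iso (pobj A 1) (pobj A 1) id_func (parr A (Ide Delta3 1)) (punit A 1)"
    by (rule A.punit_iso) (simp add: Delta3_def)
  show "natural_iso (pobj A 1) (pobj A 1) (parr A s0 \<circ>\<^sub>F parr A d0) id_func (nu0 A)"
    "natural_iso (pobj A 1) (pobj A 1) (parr A s0 \<circ>\<^sub>F parr A d1) id_func (nu1 A)"
    using natural_iso_vertical_comp[OF A.pcomp_iso[OF Delta3_generators(1,3)]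
        natural_iso_inverse[OF unit, folded Delta3_relations(2)]]
      natural_iso_vertical_comp[OF A.pcomp_iso[OF Delta3_generators(2,3)]
        natural_iso_inverse[OF unit, folded Delta3_relations(1)]]
    by (simp_all add: nu0_def[abs_def] nu1_def[abs_def])
  show "natural_iso (pobj A 1) (pobj A 3) (parr A D1 \<circ>\<^sub>F parr A d0) (parr A D0 \<circ>\<^sub>F parr A d0)
      (sigma01 A)"
    using natural_iso_vertical_comp[OF A.pcomp_iso[OF Delta3_generators(1,5), unfolded Delta3_relations]
        natural_iso_inverse[OF A.pcomp_iso[OF Delta3_generators(1,4)]]]
    by (simp add: sigma01_def[abs_def])
  show "natural_iso (pobj A 1) (pobj A 3) (parr A D2 \<circ>\<^sub>F parr A d0) (parr A D0 \<circ>\<^sub>F parr A d1)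
      (sigma02 A)"
    using natural_iso_vertical_comp[OF A.pcomp_iso[OF Delta3_generators(1,6), unfolded Delta3_relations]
        natural_iso_inverse[OF A.pcomp_iso[OF Delta3_generators(2,4)]]]
    by (simp add: sigma02_def[abs_def])
  show "natural_iso (pobj A 1) (pobj A 3) (parr A D2 \<circ>\<^sub>F parr A d1) (parr A D1 \<circ>\<^sub>F parr A d1)
      (sigma12 A)"
    using natural_iso_vertical_comp[OF A.pcomp_iso[OF Delta3_generators(2,6), unfolded Delta3_relations]
        natural_iso_inverse[OF A.pcomp_iso[OF Delta3_generators(2,5)]]]
    by (simp add: sigma12_def[abs_def])
qed

text \<open>The index \<open>True\<close> stands for the associativity equation, between arrows from \<open>D2 d1\<close> to \<open>D0 d0\<close>
  in \<open>A(3)\<close>, and \<open>False\<close> for the identity equation, between arrows from \<open>s0 d1\<close> to the identity in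
  \<open>A(1)\<close>.\<close>

lemma lax_desc_equational_dialgebras:
  assumes "pseudofunctor Delta3 A"
  shows "equational_dialgebras (lax_desc A) (pobj A 1) (pobj A 2) lax_desc_forget
    (parr A d1) (parr A d0) snd
    (\<lambda>i. if i then pobj A 3 else pobj A 1)
    (\<lambda>i. if i then parr A D2 \<circ>\<^sub>F parr A d1 else parr A s0 \<circ>\<^sub>F parr A d1)
    (\<lambda>i. if i then parr A D0 \<circ>\<^sub>F parr A d0 else id_func)
    (\<lambda>i w \<phi>. if i
       then amap (parr A D0) \<phi> \<cdot>\<^bsub>pobj A 3\<^esub> sigma02 A w \<cdot>\<^bsub>pobj A 3\<^esub> amap (parr A D2) \<phi>
       else nu0 A w \<cdot>\<^bsub>pobj A 1\<^esub> amap (parr A s0) \<phi>)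
    (\<lambda>i w \<phi>. if i
       then sigma01 A w \<cdot>\<^bsub>pobj A 3\<^esub> amap (parr A D1) \<phi> \<cdot>\<^bsub>pobj A 3\<^esub> sigma12 A w
       else nu1 A w)"
proof -
  note One_nat_def [simp del]
  interpret A: pseudofunctor Delta3 A by fact
  note functors = A.parr_functor[OF Delta3_generators(1)] A.parr_functor[OF Delta3_generators(2)]
    A.parr_functor[OF Delta3_generators(3)] A.parr_functor[OF Delta3_generators(4)]
    A.parr_functor[OF Delta3_generators(5)] A.parr_functor[OF Delta3_generators(6)]
  note cells = descent_cells_natural[OF assms]
  note D1d0 = natural_iso.axioms(1)[OF cells(1)] and D0d0 = natural_iso.axioms(2)[OF cells(1)]
    and D2d0 = natural_iso.axioms(1)[OF cells(2)] and D0d1 = natural_iso.axioms(2)[OF cells(2)]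
    and D2d1 = natural_iso.axioms(1)[OF cells(3)] and D1d1 = natural_iso.axioms(2)[OF cells(3)]
    and s0d0 = natural_iso.axioms(1)[OF cells(4)] and s0d1 = natural_iso.axioms(1)[OF cells(5)]
    and id = natural_iso.axioms(2)[OF cells(4)]
  note image = dialgebra_term_image[OF functors(2,1)]
  have hom_iff: "f \<in> hom (lax_desc A) p q \<longleftrightarrow> (\<exists>m. f = (p, m, q)
      \<and> descent_datum A p \<and> descent_datum A q \<and> m \<in> hom (pobj A 1) (fst p) (fst q)
      \<and> amap (parr A d0) m \<cdot>\<^bsub>pobj A 2\<^esub> snd p = snd q \<cdot>\<^bsub>pobj A 2\<^esub> amap (parr A d1) m)" for f p q
    by (cases p; cases q; auto simp: hom_def lax_desc_def)
  have obj_iff: "p \<in> Obj (lax_desc A) \<longleftrightarrow> descent_datum A p" for p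
    by (simp add: lax_desc_def)
  have forget: "omap lax_desc_forget p = fst p" "amap lax_desc_forget (p, m, q) = m" for p m q
    by (simp_all add: lax_desc_forget_def)
  show ?thesis
  proof (intro equational_dialgebras.intro equational_dialgebras_axioms.intro)
    show "cat_functor (pobj A 1) (if i then pobj A 3 else pobj A 1)
        (if i then parr A D2 \<circ>\<^sub>F parr A d1 else parr A s0 \<circ>\<^sub>F parr A d1)"
      "cat_functor (pobj A 1) (if i then pobj A 3 else pobj A 1)
        (if i then parr A D0 \<circ>\<^sub>F parr A d0 else id_func)" for i
      using D2d1 s0d1 D0d0 id by simp_all
    show "dialgebra_term (pobj A 1) (pobj A 2) (parr A d1) (parr A d0)
        (if i then pobj A 3 else pobj A 1)
        (if i then parr A D2 \<circ>\<^sub>F parr A d1 else parr A s0 \<circ>\<^sub>F parr A d1)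
        (if i then parr A D0 \<circ>\<^sub>F parr A d0 else id_func)
        (\<lambda>w \<phi>. if i
           then amap (parr A D0) \<phi> \<cdot>\<^bsub>pobj A 3\<^esub> sigma02 A w \<cdot>\<^bsub>pobj A 3\<^esub> amap (parr A D2) \<phi>
           else nu0 A w \<cdot>\<^bsub>pobj A 1\<^esub> amap (parr A s0) \<phi>)" for i
      using dialgebra_term_comp[OF D2d1 D2d0 D0d0 image[OF functors(6)]
          dialgebra_term_comp[OF D2d0 D0d1 D0d0 dialgebra_term_natural[OF cells(2)]
            image[OF functors(4)]]]
        dialgebra_term_comp[OF s0d1 s0d0 id image[OF functors(3)] dialgebra_term_natural[OF cells(4)]]
      by (cases i) simp_all
    show "dialgebra_term (pobj A 1) (pobj A 2) (parr A d1) (parr A d0)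
        (if i then pobj A 3 else pobj A 1)
        (if i then parr A D2 \<circ>\<^sub>F parr A d1 else parr A s0 \<circ>\<^sub>F parr A d1)
        (if i then parr A D0 \<circ>\<^sub>F parr A d0 else id_func)
        (\<lambda>w \<phi>. if i
           then sigma01 A w \<cdot>\<^bsub>pobj A 3\<^esub> amap (parr A D1) \<phi> \<cdot>\<^bsub>pobj A 3\<^esub> sigma12 A w
           else nu1 A w)" for i
      using dialgebra_term_comp[OF D2d1 D1d1 D0d0 dialgebra_term_natural[OF cells(3)]
          dialgebra_term_comp[OF D1d1 D1d0 D0d0 image[OF functors(5)]
            dialgebra_term_natural[OF cells(1)]]]
        dialgebra_term_natural[OF cells(5)]
      by (cases i) simp_all
  next
    fix w \<phi>
    assume "w \<in> Obj (pobj A 1)" "\<phi> \<in> hom (pobj A 2) (omap (parr A d1) w) (omap (parr A d0) w)"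
      and eqs: "\<And>i. (if i
           then amap (parr A D0) \<phi> \<cdot>\<^bsub>pobj A 3\<^esub> sigma02 A w \<cdot>\<^bsub>pobj A 3\<^esub> amap (parr A D2) \<phi>
           else nu0 A w \<cdot>\<^bsub>pobj A 1\<^esub> amap (parr A s0) \<phi>)
         = (if i
           then sigma01 A w \<cdot>\<^bsub>pobj A 3\<^esub> amap (parr A D1) \<phi> \<cdot>\<^bsub>pobj A 3\<^esub> sigma12 A w
           else nu1 A w)"
    then have "descent_datum A (w, \<phi>)"
      using eqs[of True, simplified] eqs[of False, simplified] by (simp add: descent_datum_def)
    then show "\<exists>p \<in> Obj (lax_desc A). omap lax_desc_forget p = w \<and> snd p = \<phi>"
      by (intro bexI[of _ "(w, \<phi>)"]) (auto simp: obj_iff forget)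
  next
    fix p q m
    assume "p \<in> Obj (lax_desc A)" "q \<in> Obj (lax_desc A)"
      "m \<in> hom (pobj A 1) (omap lax_desc_forget p) (omap lax_desc_forget q)"
      "amap (parr A d0) m \<cdot>\<^bsub>pobj A 2\<^esub> snd p = snd q \<cdot>\<^bsub>pobj A 2\<^esub> amap (parr A d1) m"
    then show "\<exists>f \<in> hom (lax_desc A) p q. amap lax_desc_forget f = m"
      by (intro bexI[of _ "(p, m, q)"]) (simp_all add: hom_iff obj_iff forget)
  qed (use functors in \<open>auto simp: hom_iff obj_iff forget descent_datum_def split: if_splits
        intro: category_lax_desc(2)[OF assms]\<close>)
qed

theorem corollary2p6:
  fixes A :: "(nat, ord_map, 'o, 'a) pseudo"
    and B :: "('ob, 'ab) cat" and C :: "('oc, 'ac) cat"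
  assumes "pseudofunctor Delta3 A"
  shows "(\<forall>E F. equivalence (pobj A 1) C E
              \<and> eq_functor (lax_desc A) C F (E \<circ>\<^sub>F lax_desc_forget) \<longrightarrow>
            creates_absolute_limits TYPE(('s, 't) cat) TYPE(('o, 'a) cat) (lax_desc A) C F
            \<and> creates_absolute_colimits TYPE(('s, 't) cat) TYPE(('o, 'a) cat) (lax_desc A) C F)
       \<and> (\<forall>E F. equivalence B (lax_desc A) E
              \<and> eq_functor B (pobj A 1) F (lax_desc_forget \<circ>\<^sub>F E) \<longrightarrow>
            creates_absolute_limits TYPE(('s, 't) cat) TYPE(('o, 'a) cat) B (pobj A 1) F
            \<and> creates_absolute_colimits TYPE(('s, 't) cat) TYPE(('o, 'a) cat) B (pobj A 1) F)"
proof -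
  note dialgebras = lax_desc_equational_dialgebras[OF assms]
  note forget_functor = category_lax_desc(2)[OF assms]
  note limits = equational_dialgebras.creates_absolute_limits[OF dialgebras]
    and colimits = equational_dialgebras.creates_absolute_limits[OF
      equational_dialgebras.opposite[OF dialgebras]]
  show ?thesis
    unfolding creates_absolute_colimits_def
    using creates_absolute_limits_cong[OF _
        creates_absolute_limits_postcomp_equivalence[OF forget_functor limits]]
      creates_absolute_limits_cong[OF _
        creates_absolute_limits_precomp_equivalence[OF forget_functor limits]]
      creates_absolute_limits_cong[OF eq_functor_op
        creates_absolute_limits_postcomp_equivalence[OF cat_functor_op[OF forget_functor] colimits equivalence_op]]
      creates_absolute_limits_cong[OF eq_functor_op
        creates_absolute_limits_precomp_equivalence[OF cat_functor_op[OF forget_functor] colimits equivalence_op]]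
    by blast
qed

end
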